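(* Let $(v_l(0))_{l\ge1}$ be non-negative with $\sum_l v_l(0)=1$ and $\sum_l l^3v_l(0)<\infty$, let $T_{gel}=\big(\sum_l l v_l(0)\big)^{-1}$, let $\psi_y$ ($y>T_{gel}$) be the characteristic curves and $C$ the limiting tagged-cluster process associated to $(v_l(0))_{l\ge1}$. Then for every $t\ge0$, $\lim_{y\to\infty}\psi_y(t)=0$. The characteristic curves fill $[0,\infty)\times(0,1)$, i.e. for every $(t,z)\in[0,\infty)\times(0,1)$ there is $y>T_{gel}$ with $\psi_y(t)=z$. Moreover, $C$ almost surely explodes infinitely often.
   Context: Here $\mathbb{N}=\{1,2,\dots\}$. Critical forest fire equations. Given $v_l(0)\ge0$ with $\sum_l v_l(0)=1$ and $\sum_l l^3v_l(0)<\infty$, it is known (Ráth–Tóth) that there is a unique solution $(v_k(t))_{k\ge1,\,t\ge0}$, with values in $[0,1]$ and each $v_k$ continuous, of $$\frac{dv_k(t)}{dt}=-kv_k(t)+\frac k2\sum_{l=1}^{k-1}v_l(t)v_{k-l}(t)\ \ (k\ge2),\qquad \sum_{l=1}^\infty v_l(t)=1\ \ (t\ge0).$$ Put $X_t(z)=\sum_{k\ge1}z^kv_k(t)$ for $z\in[0,1]$. Characteristic curves. For each $y>T_{gel}$, $\psi_y:[0,\infty)\to(0,1]$ is the unique continuous function with $\psi_y(t)=1$ for $t\ge y$, $\psi_y(t)<1$ for $t<y$, and $\frac{d}{dt}\psi_y(t)=\psi_y(t)\big(1-X_t(\psi_y(t))\big)$ for $t>0$. State space $E$. $E=\mathbb{N}$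 with the metric $d_E(i,j)=|f(i)-f(j)|$, where $f(1)=0$ and $f(i)=1/i$ for $i\ge2$. Thus $E$ is compact, $n\to1$ in $E$ as $n\to\infty$, and $1$ is the only non-isolated point. Process $C$. $C=(C_t)_{t\ge0}$ is the unique càdlàg $E$-valued strong Markov process such that: the law of $C_0$ is $k\mapsto v_k(0)$; $C$ jumps out of state $k$ at rate $k$, and when such a jump occurs at time $\tau$, then, conditionally on $\tau$, the value of $C$ increases by $L$, where $L$ has law $\mathbb{P}_\tau[L=l]=v_l(\tau)$. Explosion. $C$ explodes at the (random) time $t>0$ if $C_t=1$ and for some (random) $\epsilon>0$, $C_s\ne1$ for all $s\in(t-\epsilon,t)$; equivalently, $C$ makes infinitely many jumps in $(s,t)$ for every $s<t$. *)

theory Defs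
  imports "HOL-Probability.Probability"
begin

text \<open>
  Cluster sizes are the natural numbers \<open>k \<ge> 1\<close>, and times are the real numbers \<open>t \<ge> 0\<close>.
  Families such as \<open>v k t\<close> are total functions whose values at \<open>k = 0\<close> or \<open>t < 0\<close> are
  never constrained nor used.
\<close>

definition admissible_initial :: "(nat \<Rightarrow> real) \<Rightarrow> bool" where
  "admissible_initial v0 \<longleftrightarrow>
     (\<forall>l\<ge>1. 0 \<le> v0 l) \<and>
     (v0 has_sum 1) {1..} \<and>
     (\<lambda>l. real l ^ 3 * v0 l) summable_on {1..}"

text \<open>At \<open>t = 0\<close> the derivative is one-sided.\<close>

definition critical_forest_fire_solution :: "(nat \<Rightarrow> real) \<Rightarrow> (nat \<Rightarrow> real \<Rightarrow> real) \<Rightarrow> bool" where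
  "critical_forest_fire_solution v0 v \<longleftrightarrow>
     (\<forall>k\<ge>1. v k 0 = v0 k) \<and>
     (\<forall>k\<ge>1. \<forall>t\<ge>0. v k t \<in> {0..1}) \<and>
     (\<forall>k\<ge>1. continuous_on {0..} (v k)) \<and>
     (\<forall>k\<ge>2. \<forall>t\<ge>0.
        (v k has_real_derivative
           - real k * v k t + real k / 2 * (\<Sum>l=1..k - 1. v l t * v (k - l) t)) (at t within {0..})) \<and>
     (\<forall>t\<ge>0. ((\<lambda>l. v l t) has_sum 1) {1..})"

definition T_gel :: "(nat \<Rightarrow> real) \<Rightarrow> real" where
  "T_gel v0 = inverse (\<Sum>\<^sub>\<infinity>l\<in>{1..}. real l * v0 l)"

definition X_gen :: "(nat \<Rightarrow> real \<Rightarrow> real) \<Rightarrow> real \<Rightarrow> real \<Rightarrow> real" where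
  "X_gen v t z = (\<Sum>\<^sub>\<infinity>k\<in>{1..}. z ^ k * v k t)"

definition characteristic_curve :: "(nat \<Rightarrow> real \<Rightarrow> real) \<Rightarrow> real \<Rightarrow> (real \<Rightarrow> real) \<Rightarrow> bool" where
  "characteristic_curve v y \<psi> \<longleftrightarrow>
     continuous_on {0..} \<psi> \<and>
     (\<forall>t\<ge>0. \<psi> t \<in> {0<..1}) \<and>
     (\<forall>t\<ge>0. y \<le> t \<longrightarrow> \<psi> t = 1) \<and>
     (\<forall>t\<ge>0. t < y \<longrightarrow> \<psi> t < 1) \<and>
     (\<forall>t>0. (\<psi> has_real_derivative \<psi> t * (1 - X_gen v t (\<psi> t))) (at t))"


subsection \<open>The state space\<close>

definition f_E :: "nat \<Rightarrow> real" where
  "f_E i = (if i = 1 then 0 else 1 / real i)"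

definition d_E :: "nat \<Rightarrow> nat \<Rightarrow> real" where
  "d_E i j = \<bar>f_E i - f_E j\<bar>"

interpretation E: Metric_space "{1::nat..}" d_E
proof
  show "d_E x y = 0 \<longleftrightarrow> x = y" if "x \<in> {1..}" "y \<in> {1..}" for x y
    using that by (auto simp: d_E_def f_E_def split: if_splits)
qed (auto simp: d_E_def)

definition cadlag_E :: "(real \<Rightarrow> nat) \<Rightarrow> bool" where
  "cadlag_E x \<longleftrightarrow>
     (\<forall>t\<ge>0. x t \<in> {1..}) \<and>
     (\<forall>t\<ge>0. limitin E.mtopology x (x t) (at_right t)) \<and>
     (\<forall>t>0. \<exists>l. limitin E.mtopology x l (at_left t))"

text \<open>The only discontinuities of \<open>x\<close> are jumps out of a state in which \<open>x\<close> has just been sitting.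
  This makes \<open>x\<close> continuous at every accumulation point (from the left) of jumps; since \<open>1\<close> is the
  only non-isolated point of \<open>E\<close>, the value there is \<open>1\<close>.\<close>

definition jumps_only_out_of_states :: "(real \<Rightarrow> nat) \<Rightarrow> bool" where
  "jumps_only_out_of_states x \<longleftrightarrow>
     (\<forall>t>0. (\<exists>k. eventually (\<lambda>s. x s = k) (at_left t)) \<or> limitin E.mtopology x (x t) (at_left t))"

text \<open>The first jump after time \<open>t\<close> is made at some time in \<open>{t<..t+s}\<close> and increases \<open>x\<close> by \<open>l\<close>.\<close>

definition next_jump :: "(real \<Rightarrow> nat) \<Rightarrow> real \<Rightarrow> real \<Rightarrow> nat \<Rightarrow> bool" where
  "next_jump x t s l \<longleftrightarrow>
     (\<exists>u\<in>{0<..s}. (\<forall>r\<in>{t..<t + u}. x r = x t) \<and> x (t + u) = x t + l)"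

definition explodes_at :: "(real \<Rightarrow> nat) \<Rightarrow> real \<Rightarrow> bool" where
  "explodes_at x t \<longleftrightarrow> 0 < t \<and> x t = 1 \<and> (\<exists>\<epsilon>>0. \<forall>s\<in>{t - \<epsilon><..<t}. 0 \<le> s \<longrightarrow> x s \<noteq> 1)"


subsection \<open>The tagged-cluster process\<close>

definition natural_filtration :: "'a measure \<Rightarrow> (real \<Rightarrow> 'a \<Rightarrow> nat) \<Rightarrow> real \<Rightarrow> 'a measure" where
  "natural_filtration M C t =
     sigma (space M) {C s -` A \<inter> space M |s A. 0 \<le> s \<and> s \<le> t}"

lemma filtration_natural_filtration: "filtration (space M) (natural_filtration M C)"
proof
  show "space (natural_filtration M C i) = space M" for i
    unfolding natural_filtration_def by (rule space_measure_of) auto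
  show "sets (natural_filtration M C i) \<subseteq> sets (natural_filtration M C j)" if "i \<le> j" for i j
  proof -
    have "{C s -` A \<inter> space M |s A. 0 \<le> s \<and> s \<le> i} \<subseteq> {C s -` A \<inter> space M |s A. 0 \<le> s \<and> s \<le> j}"
      using that by fastforce
    moreover have "{C s -` A \<inter> space M |s A. 0 \<le> s \<and> s \<le> t} \<subseteq> Pow (space M)" for t
      by auto
    ultimately show ?thesis
      unfolding natural_filtration_def by (simp add: sigma_sets_mono')
  qed
qed

text \<open>Finite stopping times suffice: a stopping time \<open>T\<close> with values in \<open>[0,\<infinity>]\<close> agrees with the
  stopping time \<open>min T n\<close> on \<open>{T \<le> n}\<close>.\<close>

definition finite_stopping_time :: "'a measure \<Rightarrow> (real \<Rightarrow> 'a \<Rightarrow> nat) \<Rightarrow> ('a \<Rightarrow> real) \<Rightarrow> bool" where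
  "finite_stopping_time M C T \<longleftrightarrow>
     stopping_time (natural_filtration M C) T \<and> (\<forall>\<omega>\<in>space M. 0 \<le> T \<omega>)"

definition cond_prob_at ::
  "'a measure \<Rightarrow> (real \<Rightarrow> 'a \<Rightarrow> nat) \<Rightarrow> ('a \<Rightarrow> real) \<Rightarrow> ('a \<Rightarrow> bool) \<Rightarrow> 'a \<Rightarrow> real" where
  "cond_prob_at M C T P =
     real_cond_exp M (filtration.pre_sigma (space M) (natural_filtration M C) T)
       (indicator {\<omega>\<in>space M. P \<omega>})"

text \<open>The process is time-inhomogeneous: \<open>p r i u\<close> is the law at time \<open>r + u\<close> of the process
  started in state \<open>i\<close> at time \<open>r\<close>.\<close>

definition strong_Markov :: "'a measure \<Rightarrow> (real \<Rightarrow> 'a \<Rightarrow> nat) \<Rightarrow> bool" where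
  "strong_Markov M C \<longleftrightarrow>
     (\<exists>p :: real \<Rightarrow> nat \<Rightarrow> real \<Rightarrow> nat pmf. \<forall>T. finite_stopping_time M C T \<longrightarrow>
        (\<forall>u\<ge>0. \<forall>j\<ge>1. AE \<omega> in M.
           cond_prob_at M C T (\<lambda>\<omega>. C (T \<omega> + u) \<omega> = j) \<omega> = pmf (p (T \<omega>) (C (T \<omega>) \<omega>) u) j))"

text \<open>If the process is in state \<open>k\<close> at the stopping time \<open>T\<close> then, given the past up to \<open>T\<close>, the
  time \<open>\<tau>\<close> of the next jump is such that \<open>\<tau> - T\<close> is exponential with rate \<open>k\<close>, and given also \<open>\<tau>\<close>
  the increment \<open>L\<close> equals \<open>l\<close> with probability \<open>v l \<tau>\<close>.  The integral is thus the conditional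
  probability that \<open>\<tau> - T \<le> s\<close> and \<open>L = l\<close>.  Stopping times, rather than fixed times, are needed
  because the visits to \<open>1\<close> after an explosion begin at random times.\<close>

definition jump_dynamics ::
  "(nat \<Rightarrow> real \<Rightarrow> real) \<Rightarrow> 'a measure \<Rightarrow> (real \<Rightarrow> 'a \<Rightarrow> nat) \<Rightarrow> bool" where
  "jump_dynamics v M C \<longleftrightarrow>
     (\<forall>T. finite_stopping_time M C T \<longrightarrow>
        (\<forall>s\<ge>0. \<forall>l\<ge>1. AE \<omega> in M.
           cond_prob_at M C T (\<lambda>\<omega>. next_jump (\<lambda>t. C t \<omega>) (T \<omega>) s l) \<omega> =
           (let k = real (C (T \<omega>) \<omega>)
            in integral {0..s} (\<lambda>u. k * exp (- k * u) * v l (T \<omega> + u)))))"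

definition tagged_cluster_process ::
  "(nat \<Rightarrow> real \<Rightarrow> real) \<Rightarrow> 'a measure \<Rightarrow> (real \<Rightarrow> 'a \<Rightarrow> nat) \<Rightarrow> bool" where
  "tagged_cluster_process v M C \<longleftrightarrow>
     prob_space M \<and>
     (\<forall>t\<ge>0. C t \<in> M \<rightarrow>\<^sub>M count_space UNIV) \<and>
     (\<forall>\<omega>\<in>space M. cadlag_E (\<lambda>t. C t \<omega>)) \<and>
     (\<forall>k\<ge>1. measure M {\<omega>\<in>space M. C 0 \<omega> = k} = v k 0) \<and>
     strong_Markov M C \<and>
     (AE \<omega> in M. jumps_only_out_of_states (\<lambda>t. C t \<omega>)) \<and>
     jump_dynamics v M C"

end

(*
  Write X(t,z) for the generating function and F(t) for v_1(t) plus the integral of v_1 over [0,t].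
  The function F is nondecreasing and unbounded. Along a characteristic curve z(t) one has
  formally X' = z F', so X - c F is nondecreasing as long as c <= z, and for two ordered curves the
  difference of the values of X is nondecreasing. With c = psi_y(t) the first fact gives
  psi_y(t) (F(y) - F(t)) <= 1, hence psi_y(t) -> 0. The second one gives the monotonicity of psi_y(t)
  in y and, since X is strictly increasing in z, the continuity of X(t, psi_y(t)) in y, so that the
  intermediate value theorem applies. For t <= T_gel one needs in addition that psi_y(0) -> 1 as
  y decreases to T_gel.

  Until the first explosion psi_y(t)^C_t is a martingale. Let A be the event that C does not explode
  in [n,y], which forces C to be nondecreasing on [n,y]. Discretising time gives the supermartingale
  inequality P(A) <= E(psi_y(n)^C_n) <= psi_y(n), and letting y tend to infinity shows that almost
  surely there is an explosion after every n.
*)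

theory Submission
  imports Defs
begin

text \<open>The equations say nothing about the derivative of \<open>v 1\<close>; only conservation
  of mass controls it. Hence \<open>F\<close> is known to be continuous and nondecreasing, but
  \<open>X' = z * F'\<close> cannot be taken literally. It is used in the form
  \<open>(X - z * F)' = - z' * F\<close>, where only honest derivatives occur, and the monotone
  factor is handled by one-sided lower derivatives. Both properties of \<open>F\<close> come from
  truncated sums: weighting sizes by 1 shows that coagulation creates no mass, weighting them by
  \<open>1 / k\<close> gives linear growth. The process is accessible through the law of its next
  jump only. A time grid therefore uses just the first jump in each step; further jumps of an
  increasing path lower \<open>z ^ C\<close> even more, so ignoring them costs nothing. Errors of a
  step are uniform only over bounded states, which is why a cut-off \<open>N\<close> is carried
  along and removed at the very end.\<close>

section \<open>Real analysis: uniformity by compactness, monotonicity by lower derivatives\<close>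

lemma dini_eventually_gt:
  fixes f :: "nat \<Rightarrow> 'a::topological_space \<Rightarrow> real"
  assumes "compact S" and cont: "\<And>n. continuous_on S (f n)"
    and mono: "\<And>x m n. x \<in> S \<Longrightarrow> m \<le> n \<Longrightarrow> f m x \<le> f n x"
    and lim: "\<And>x. x \<in> S \<Longrightarrow> (\<lambda>n. f n x) \<longlonglongrightarrow> l" and "c < l"
  shows "\<exists>N. \<forall>n\<ge>N. \<forall>x\<in>S. c < f n x"
proof -
  have "\<exists>U. open U \<and> U \<inter> S = f n -` {c<..} \<inter> S" for n
    using cont[of n] by (metis continuous_on_open_invariant open_greaterThan)
  then obtain U where U: "\<And>n. open (U n)" "\<And>n. U n \<inter> S = f n -` {c<..} \<inter> S"
    by metis
  have "S \<subseteq> (\<Union>n\<in>UNIV. U n)"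
  proof
    fix x assume x: "x \<in> S"
    obtain n where "c < f n x"
      using order_tendstoD(1)[OF lim[OF x] \<open>c < l\<close>] by (auto simp: eventually_sequentially)
    then show "x \<in> (\<Union>n\<in>UNIV. U n)"
      using U(2)[of n] x by auto
  qed
  then obtain I where I: "finite I" "S \<subseteq> (\<Union>n\<in>I. U n)"
    using compactE_image[OF \<open>compact S\<close>, of UNIV U] U(1) by metis
  have "c < f n x" if "n \<ge> Max (insert 0 I)" "x \<in> S" for n x
  proof -
    obtain i where i: "i \<in> I" "x \<in> U i" using I(2) \<open>x \<in> S\<close> by auto
    then have "c < f i x" using U(2)[of i] that by auto
    moreover have "i \<le> n" using i I that by auto
    ultimately show ?thesis using mono[OF that(2), of i n] by linarith
  qed
  then show ?thesis by blast
qed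

text \<open>With slack \<open>e\<close> per unit of time, the set of times at which the lower bound
  started at \<open>c\<close> holds is closed, and the hypothesis pushes its supremum up to
  \<open>b\<close>. The start is at \<open>c > a\<close>, because at \<open>a\<close> itself only
  continuity is available.\<close>

lemma nondecreasing_if_lower_derivative_nonneg:
  fixes G :: "real \<Rightarrow> real"
  assumes "a \<le> b" and cont: "continuous_on {a..b} G"
    and lower: "\<And>s e. a < s \<Longrightarrow> s < b \<Longrightarrow> 0 < e \<Longrightarrow>
      eventually (\<lambda>t. G s - e * (t - s) \<le> G t) (at_right s)"
  shows "G a \<le> G b"
proof -
  have step: "G c - e * (b - c) \<le> G b" if c: "a < c" "c \<le> b" and e: "0 < e" for c e
  proof -
    define A where "A = {t\<in>{c..b}. G c - e * (t - c) \<le> G t}"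
    have cont': "continuous_on {c..b} G" using cont c by (auto intro: continuous_on_subset)
    have "closed A"
      unfolding A_def by (intro continuous_on_closed_Collect_le continuous_intros cont' closed_atLeastAtMost)
    moreover have "c \<in> A" using c by (auto simp: A_def)
    moreover have "bounded A" by (rule bounded_subset[of "{c..b}"]) (auto simp: A_def)
    ultimately have m: "Sup A \<in> A" and up: "\<And>t. t \<in> A \<Longrightarrow> t \<le> Sup A"
      by (auto intro!: closed_contains_Sup cSup_upper bounded_imp_bdd_above)
    have "Sup A = b"
    proof (rule ccontr)
      assume "Sup A \<noteq> b"
      then have s: "c \<le> Sup A" "Sup A < b" using m by (auto simp: A_def)
      have "eventually (\<lambda>t. G (Sup A) - e * (t - Sup A) \<le> G t \<and> t \<in> {Sup A<..<b}) (at_right (Sup A))"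
        using lower[of "Sup A" e] s c e eventually_at_right_real[OF s(2)] by (auto intro: eventually_conj)
      then obtain t where t: "G (Sup A) - e * (t - Sup A) \<le> G t" "t \<in> {Sup A<..<b}"
        using eventually_happens'[of "at_right (Sup A)"] trivial_limit_at_right_real by blast
      have "G c - e * (Sup A - c) \<le> G (Sup A)" using m by (auto simp: A_def)
      then have "t \<in> A" using t s by (auto simp: A_def algebra_simps)
      then show False using up[of t] t by auto
    qed
    then show ?thesis using m by (auto simp: A_def)
  qed
  have "G c \<le> G b" if "a < c" "c \<le> b" for c
  proof (rule field_le_epsilon)
    fix e :: real assume e: "0 < e"
    \<comment> \<open>The \<open>+ 1\<close> keeps the slope positive when
      \<open>c = b\<close>.\<close>
    have "e / (b - c + 1) * (b - c) \<le> e" using e that by (simp add: field_simps)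
    then show "G c \<le> G b + e"
      using step[OF that, of "e / (b - c + 1)"] e that by simp
  qed
  note le = this
  show ?thesis
  proof (cases "a = b")
    case False
    have "(G \<longlongrightarrow> G a) (at_right a)"
      using cont False \<open>a \<le> b\<close> by (simp add: continuous_on_Icc_at_rightD)
    moreover have "eventually (\<lambda>c. G c \<le> G b) (at_right a)"
      using le False \<open>a \<le> b\<close> eventually_at_right_real[of a b]
      by (auto elim!: eventually_mono)
    ultimately show ?thesis
      using tendsto_upperbound trivial_limit_at_right_real by blast
  qed simp
qed

text \<open>Formally the derivative of \<open>H + \<eta> * F\<close> is \<open>\<eta> * F'\<close>; the lower derivative avoids
  differentiating the monotone function \<open>F\<close>.\<close>

lemma integration_by_parts_mono:
  fixes H \<eta> F :: "real \<Rightarrow> real"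
  assumes "a \<le> b"
    and cont: "continuous_on {a..b} H" "continuous_on {a..b} \<eta>" "continuous_on {a..b} F"
    and H': "\<And>s. a < s \<Longrightarrow> s < b \<Longrightarrow> (H has_real_derivative - \<eta>' s * F s) (at s)"
    and \<eta>': "\<And>s. a < s \<Longrightarrow> s < b \<Longrightarrow> (\<eta> has_real_derivative \<eta>' s) (at s)"
    and nonneg: "\<And>s. a \<le> s \<Longrightarrow> s \<le> b \<Longrightarrow> 0 \<le> \<eta> s"
    and mono: "\<And>s t. a \<le> s \<Longrightarrow> s \<le> t \<Longrightarrow> t \<le> b \<Longrightarrow> F s \<le> F t"
  shows "H a + \<eta> a * F a \<le> H b + \<eta> b * F b"
proof (rule nondecreasing_if_lower_derivative_nonneg[where G = "\<lambda>t. H t + \<eta> t * F t"])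
  show "continuous_on {a..b} (\<lambda>t. H t + \<eta> t * F t)" by (intro continuous_intros cont)
  fix s e :: real assume s: "a < s" "s < b" and e: "0 < e"
  \<comment> \<open>\<open>g\<close> freezes \<open>F\<close> at time \<open>s\<close>. Its
    derivative at \<open>s\<close> is \<open>- \<eta>' s * F s + \<eta>' s * F s = 0\<close>, and
    the neglected part \<open>\<eta> t * (F t - F s)\<close> is nonnegative.\<close>
  define g where "g t = H t + \<eta> t * F s" for t
  have "(g has_real_derivative 0) (at s)"
    unfolding g_def by (auto intro!: derivative_eq_intros H' \<eta>' s)
  then have "((\<lambda>t. (g t - g s) / (t - s)) \<longlongrightarrow> 0) (at s)"
    by (simp add: has_field_derivative_iff)
  then have "eventually (\<lambda>t. - e < (g t - g s) / (t - s)) (at s)"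
    using e by (intro order_tendstoD(1)) auto
  then have "eventually (\<lambda>t. - e < (g t - g s) / (t - s)) (at_right s)"
    by (rule filter_leD[OF at_le, rotated]) simp
  then show "eventually (\<lambda>t. H s + \<eta> s * F s - e * (t - s) \<le> H t + \<eta> t * F t) (at_right s)"
    using eventually_at_right_real[OF s(2)]
  proof eventually_elim
    case (elim t)
    then have "- e * (t - s) \<le> g t - g s" by (simp add: pos_less_divide_eq)
    moreover have "\<eta> t * F s \<le> \<eta> t * F t"
      using elim s by (intro mult_left_mono mono nonneg) auto
    ultimately show ?case by (simp add: g_def)
  qed
qed (use \<open>a \<le> b\<close> in auto)

section \<open>The critical forest fire equations\<close>

locale forest_fire =
  fixes v0 :: "nat \<Rightarrow> real" and v :: "nat \<Rightarrow> real \<Rightarrow> real"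
  assumes init: "admissible_initial v0" and sol: "critical_forest_fire_solution v0 v"
begin

text \<open>With the value 0 at index 0, generating functions are power series over all naturals and
  convolutions are Cauchy products.\<close>

definition u :: "nat \<Rightarrow> real \<Rightarrow> real" where
  "u k t = (if k = 0 then 0 else v k t)"

definition conv :: "nat \<Rightarrow> real \<Rightarrow> real" where
  "conv k t = (\<Sum>l\<le>k. u l t * u (k - l) t)"

abbreviation X :: "real \<Rightarrow> real \<Rightarrow> real" where "X \<equiv> X_gen v"

lemma u_0 [simp]: "u 0 t = 0"
  by (simp add: u_def)

lemma u_nonneg: "0 \<le> t \<Longrightarrow> 0 \<le> u k t" and u_le_1: "0 \<le> t \<Longrightarrow> u k t \<le> 1"
  using sol by (auto simp: u_def critical_forest_fire_solution_def)

lemma continuous_on_u: "continuous_on {0..} (u k)"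
  using sol by (cases k) (auto simp: u_def[abs_def] critical_forest_fire_solution_def)

lemma u_sums: "0 \<le> t \<Longrightarrow> (\<lambda>k. u k t) sums 1"
proof -
  assume "0 \<le> t"
  then have "((\<lambda>l. v l t) has_sum 1) {1..}"
    using sol by (auto simp: critical_forest_fire_solution_def)
  then have "((\<lambda>k. u k t) has_sum 1) UNIV"
    by (rule has_sum_cong_neutral[THEN iffD1, rotated -1]) (auto simp: u_def)
  then show ?thesis by (rule has_sum_imp_sums)
qed

lemma summable_u_power:
  assumes "0 \<le> t" "\<bar>z\<bar> \<le> 1" shows "summable (\<lambda>k. norm (u k t * z ^ k))"
proof (rule summable_comparison_test)
  show "summable (\<lambda>k. u k t)" using u_sums[OF assms(1)] by (simp add: sums_iff)
  have "norm (norm (u k t * z ^ k)) \<le> u k t" for k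
    using u_nonneg[OF assms(1), of k] mult_left_mono[of "\<bar>z\<bar> ^ k" 1 "u k t"] assms
    by (simp add: abs_mult power_abs power_le_one)
  then show "\<exists>N. \<forall>n\<ge>N. norm (norm (u n t * z ^ n)) \<le> u n t" by blast
qed

lemma X_sums:
  assumes "0 \<le> t" "0 \<le> z" "z \<le> 1" shows "(\<lambda>k. u k t * z ^ k) sums X t z"
proof -
  have "((\<lambda>k. u k t * z ^ k) has_sum (\<Sum>k. u k t * z ^ k)) UNIV"
    using summable_u_power[of t z] assms by (intro norm_summable_imp_has_sum summable_sums) (auto intro: summable_norm_cancel)
  then have "((\<lambda>k. z ^ k * v k t) has_sum (\<Sum>k. u k t * z ^ k)) {1..}"
    by (rule has_sum_cong_neutral[THEN iffD1, rotated -1]) (auto simp: u_def)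
  then have "X t z = (\<Sum>k. u k t * z ^ k)" by (simp add: X_gen_def infsumI)
  then show ?thesis
    using summable_u_power[of t z] assms by (auto simp: sums_iff intro: summable_norm_cancel)
qed

lemma X_1: "0 \<le> t \<Longrightarrow> X t 1 = 1"
  using X_sums[of t 1] sums_unique2[OF u_sums[of t]] by fastforce

lemma X_nonneg:
  assumes "0 \<le> t" "0 \<le> z" "z \<le> 1" shows "0 \<le> X t z"
  using sums_le[OF _ sums_zero X_sums[OF assms]] u_nonneg[OF assms(1)] assms(2) by simp

lemma X_mono:
  assumes "0 \<le> t" "0 \<le> z" "z \<le> w" "w \<le> 1" shows "X t z \<le> X t w"
proof (rule sums_le)
  show "(\<lambda>k. u k t * z ^ k) sums X t z" "(\<lambda>k. u k t * w ^ k) sums X t w"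
    using assms by (auto intro!: X_sums)
  show "u k t * z ^ k \<le> u k t * w ^ k" for k
    using assms by (intro mult_left_mono power_mono u_nonneg)
qed

lemma X_le_1: "0 \<le> t \<Longrightarrow> 0 \<le> z \<Longrightarrow> z \<le> 1 \<Longrightarrow> X t z \<le> 1"
  using X_mono[of t z 1] X_1 by simp

lemma X_strict_mono:
  assumes "0 \<le> t" "0 \<le> z" "z < w" "w \<le> 1" shows "X t z < X t w"
proof -
  define d where "d k = u k t * w ^ k - u k t * z ^ k" for k
  have "\<exists>k. u k t \<noteq> 0"
  proof (rule ccontr)
    assume "\<not> (\<exists>k. u k t \<noteq> 0)"
    then have "(\<lambda>k. u k t) = (\<lambda>k. 0)" by auto
    then show False using sums_unique2[OF u_sums[OF assms(1)]] sums_zero by force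
  qed
  then obtain k where k: "u k t \<noteq> 0" by blast
  then have "k \<noteq> 0" by (metis u_0)
  have d: "d sums (X t w - X t z)"
    unfolding d_def[abs_def] by (intro sums_diff X_sums) (use assms in auto)
  have "0 \<le> d j" for j
    using mult_left_mono[OF power_mono[of z w j] u_nonneg[OF assms(1), of j]] assms
    by (simp add: d_def)
  moreover have "0 < u k t" using k u_nonneg[OF assms(1), of k] by simp
  then have "0 < d k"
    using mult_strict_left_mono[OF power_strict_mono[of z w k], of "u k t"] assms \<open>k \<noteq> 0\<close>
    by (simp add: d_def)
  ultimately have "0 < X t w - X t z"
    using suminf_pos2[OF sums_summable[OF d]] sums_unique[OF d] by metis
  then show ?thesis by simp
qed

lemma partial_sums_u_le_1:
  assumes "0 \<le> t" "finite I" shows "(\<Sum>k\<in>I. u k t) \<le> 1"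
  using sum_le_suminf[OF sums_summable[OF u_sums[OF assms(1)]] assms(2)] sums_unique[OF u_sums[OF assms(1)]]
    u_nonneg[OF assms(1)] assms(1) by simp

text \<open>Conservation of mass is pointwise in time; since the partial sums are continuous and
  increasing in \<open>n\<close>, Dini's argument makes it uniform on compact intervals. All
  truncation levels that do not depend on time come from here.\<close>

lemma uniform_tails:
  assumes "0 < e"
  shows "\<exists>K. \<forall>n\<ge>K. \<forall>t\<in>{0..T}. 1 - e < (\<Sum>k<n. u k t)"
proof (rule dini_eventually_gt[where l = 1])
  show "continuous_on {0..T} (\<lambda>t. \<Sum>k<n. u k t)" for n
    by (intro continuous_intros continuous_on_subset[OF continuous_on_u]) auto
  show "(\<Sum>k<m. u k t) \<le> (\<Sum>k<n. u k t)" if "t \<in> {0..T}" "m \<le> n" for m n t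
    using that by (intro sum_mono2) (auto intro: u_nonneg)
  show "(\<lambda>n. \<Sum>k<n. u k t) \<longlonglongrightarrow> 1" if "t \<in> {0..T}" for t
    using u_sums[of t] that by (auto simp: sums_def)
qed (use assms in auto)

text \<open>As \<open>0 <= z ^ k <= 1\<close>, the tail of the series lies below the tail of the
  mass, so the error does not depend on \<open>z\<close>.\<close>

lemma X_minus_partial_sum:
  assumes "0 \<le> t" "0 \<le> z" "z \<le> 1"
  shows "\<bar>X t z - (\<Sum>k<n. u k t * z ^ k)\<bar> \<le> 1 - (\<Sum>k<n. u k t)"
proof -
  have sm: "summable (\<lambda>k. u k t * z ^ k)" "X t z = (\<Sum>k. u k t * z ^ k)"
    "summable (\<lambda>k. u k t)" "(\<Sum>k. u k t) = 1"
    using X_sums[OF assms] u_sums[OF assms(1)] by (auto simp: sums_iff)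
  have "X t z - (\<Sum>k<n. u k t * z ^ k) = (\<Sum>k. u (k + n) t * z ^ (k + n))"
    using suminf_split_initial_segment[OF sm(1), of n] sm(2) by simp
  moreover have "1 - (\<Sum>k<n. u k t) = (\<Sum>k. u (k + n) t)"
    using suminf_split_initial_segment[OF sm(3), of n] sm(4) by simp
  moreover have "(\<Sum>k. u (k + n) t * z ^ (k + n)) \<le> (\<Sum>k. u (k + n) t)"
    using sm assms u_nonneg[OF assms(1)]
    by (intro suminf_le summable_ignore_initial_segment) (auto intro!: mult_left_le power_le_one)
  moreover have "0 \<le> (\<Sum>k. u (k + n) t * z ^ (k + n))"
    using sm(1) assms u_nonneg[OF assms(1)]
    by (intro suminf_nonneg summable_ignore_initial_segment) auto
  ultimately show ?thesis by simp
qed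

lemma X_uniformly_continuous:
  assumes "0 < e"
  shows "\<exists>d>0. \<forall>t\<in>{0..T}. \<forall>z\<in>{0..1}. \<forall>w\<in>{0..1}. \<bar>z - w\<bar> \<le> d \<longrightarrow> \<bar>X t z - X t w\<bar> \<le> e"
proof -
  obtain K where K: "\<And>t. t \<in> {0..T} \<Longrightarrow> 1 - e / 3 < (\<Sum>k<K. u k t)"
    using uniform_tails[of "e / 3" T] assms by (metis divide_pos_pos zero_less_numeral order_refl)
  have "\<bar>X t z - X t w\<bar> \<le> e"
    if t: "t \<in> {0..T}" and z: "z \<in> {0..1}" and w: "w \<in> {0..1}" and zw: "\<bar>z - w\<bar> \<le> e / (3 * (real K + 1))" for t z w
  proof -
    \<comment> \<open>The truncated polynomial is Lipschitz with constant \<open>K\<close>, the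
      total mass being at most 1. The chosen radius spends a third of \<open>e\<close> on it; the
      two tails take the rest.\<close>
    have pw: "\<bar>z ^ k - w ^ k\<bar> \<le> real K * \<bar>z - w\<bar>" if "k < K" for k
    proof -
      have "norm (z ^ k - w ^ k) \<le> real k * norm (z - w)"
        using z w by (intro norm_power_diff) auto
      also have "\<dots> \<le> real K * \<bar>z - w\<bar>" using that by (auto intro: mult_right_mono)
      finally show ?thesis by simp
    qed
    have "\<bar>(\<Sum>k<K. u k t * z ^ k) - (\<Sum>k<K. u k t * w ^ k)\<bar> = \<bar>\<Sum>k<K. u k t * (z ^ k - w ^ k)\<bar>"
      by (simp add: sum_subtractf right_diff_distrib)
    also have "\<dots> \<le> (\<Sum>k<K. \<bar>u k t * (z ^ k - w ^ k)\<bar>)" by (rule sum_abs)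
    also have "\<dots> \<le> (\<Sum>k<K. u k t * (real K * \<bar>z - w\<bar>))"
      using t pw by (intro sum_mono) (auto simp: abs_mult u_nonneg intro!: mult_left_mono)
    also have "\<dots> = (\<Sum>k<K. u k t) * (real K * \<bar>z - w\<bar>)" by (simp add: sum_distrib_right)
    also have "\<dots> \<le> 1 * (real K * \<bar>z - w\<bar>)"
      using t by (intro mult_right_mono partial_sums_u_le_1) auto
    also have "\<dots> \<le> real K * (e / (3 * (real K + 1)))"
      unfolding mult_1_left by (rule mult_left_mono[OF zw]) simp
    also have "\<dots> \<le> e / 3" using assms by (simp add: field_simps)
    finally have "\<bar>(\<Sum>k<K. u k t * z ^ k) - (\<Sum>k<K. u k t * w ^ k)\<bar> \<le> e / 3" .
    moreover have "\<bar>X t z - (\<Sum>k<K. u k t * z ^ k)\<bar> < e / 3" "\<bar>X t w - (\<Sum>k<K. u k t * w ^ k)\<bar> < e / 3"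
      using X_minus_partial_sum[of t z K] X_minus_partial_sum[of t w K] K[OF t] t z w by simp_all
    ultimately show ?thesis by linarith
  qed
  then show ?thesis using assms
    by (intro exI[of _ "e / (3 * (real K + 1))"]) auto
qed

lemma continuous_on_X:
  assumes "0 \<le> a" and z: "continuous_on {a..b} z" "\<And>s. s \<in> {a..b} \<Longrightarrow> z s \<in> {0..1}"
  shows "continuous_on {a..b} (\<lambda>s. X s (z s))"
proof (rule uniform_limit_theorem)
  show "\<forall>\<^sub>F n in sequentially. continuous_on {a..b} (\<lambda>s. \<Sum>k<n. u k s * z s ^ k)"
    using assms by (intro always_eventually allI continuous_intros z continuous_on_subset[OF continuous_on_u]) auto
  show "uniform_limit {a..b} (\<lambda>n s. \<Sum>k<n. u k s * z s ^ k) (\<lambda>s. X s (z s)) sequentially"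
  proof (rule uniform_limitI)
    fix e :: real assume "0 < e"
    then obtain K where K: "\<And>n t. n \<ge> K \<Longrightarrow> t \<in> {0..b} \<Longrightarrow> 1 - e < (\<Sum>k<n. u k t)"
      using uniform_tails[of e b] by metis
    have "dist (\<Sum>k<n. u k s * z s ^ k) (X s (z s)) < e" if "n \<ge> K" "s \<in> {a..b}" for n s
      using K[of n s] X_minus_partial_sum[of s "z s" n] that assms(1) z(2)[of s]
      by (auto simp: dist_real_def abs_minus_commute)
    then show "\<forall>\<^sub>F n in sequentially. \<forall>s\<in>{a..b}. dist (\<Sum>k<n. u k s * z s ^ k) (X s (z s)) < e"
      unfolding eventually_sequentially by blast
  qed
qed simp

lemma conv_nonneg: "0 \<le> t \<Longrightarrow> 0 \<le> conv k t"
  by (auto simp: conv_def intro!: sum_nonneg mult_nonneg_nonneg u_nonneg)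

lemma conv_le_1:
  assumes "0 \<le> t" shows "conv k t \<le> 1"
proof -
  have "conv k t \<le> (\<Sum>l\<le>k. u l t)"
    unfolding conv_def using assms u_nonneg u_le_1 by (intro sum_mono mult_left_le) auto
  then show ?thesis using partial_sums_u_le_1[OF assms, of "{..k}"] by simp
qed

lemma conv_eq: "k \<ge> 1 \<Longrightarrow> conv k t = (\<Sum>l=1..k - 1. v l t * v (k - l) t)"
  unfolding conv_def by (rule sum.mono_neutral_cong_right) (auto simp: u_def)

lemma conv_le_1_eq_0: "k \<le> 1 \<Longrightarrow> conv k t = 0"
  by (cases k) (auto simp: conv_def)

lemma u_deriv:
  assumes "2 \<le> k" "0 < t"
  shows "(u k has_real_derivative - real k * u k t + real k / 2 * conv k t) (at t)"
proof -
  have "(v k has_real_derivative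
       - real k * v k t + real k / 2 * (\<Sum>l=1..k - 1. v l t * v (k - l) t)) (at t within {0..})"
    using sol assms unfolding critical_forest_fire_solution_def by auto
  moreover have "at t within {0..} = at t"
    using assms by (intro at_within_interior) (simp add: interior_Ici[where b="-1"])
  moreover have "u k = v k" using assms by (auto simp: u_def)
  ultimately show ?thesis using assms by (simp add: conv_eq)
qed

end

section \<open>Coagulation sums, the function \<open>F\<close>, and the transport of
  \<open>X\<close> along the flow\<close>

text \<open>The triangle \<open>i + j <= n\<close> lies in a square: truncated coagulation gains are
  bounded by products of truncated totals.\<close>

lemma sum_convolution_le:
  fixes a b :: "nat \<Rightarrow> real"
  assumes "\<And>k. 0 \<le> a k" "\<And>k. 0 \<le> b k"
  shows "(\<Sum>k\<le>n. \<Sum>l\<le>k. a l * b (k - l)) \<le> (\<Sum>k\<le>n. a k) * (\<Sum>k\<le>n. b k)"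
proof -
  have "(\<Sum>k\<le>n. \<Sum>l\<le>k. a l * b (k - l)) = (\<Sum>(i,j)\<in>{(i,j). i + j \<le> n}. a i * b j)"
    by (rule sum.triangle_reindex_eq[symmetric])
  also have "\<dots> \<le> (\<Sum>(i,j)\<in>{..n} \<times> {..n}. a i * b j)"
    using assms by (intro sum_mono2) auto
  also have "\<dots> = (\<Sum>k\<le>n. a k) * (\<Sum>k\<le>n. b k)"
    by (simp add: sum_product sum.cartesian_product)
  finally show ?thesis .
qed

context forest_fire
begin

text \<open>Symmetry under exchanging \<open>l\<close> and \<open>k - l\<close>. It exhibits the
  gain terms as the coefficients of the product of \<open>X\<close> with \<open>z\<close> times its
  z-derivative.\<close>

lemma weighted_conv: "real k / 2 * conv k t = (\<Sum>l\<le>k. real l * u l t * u (k - l) t)"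
proof -
  have "(\<Sum>l\<le>k. real l * u l t * u (k - l) t) = (\<Sum>l\<le>k. real (k - l) * u (k - l) t * u l t)"
    by (rule sum.reindex_bij_witness[of _ "\<lambda>l. k - l" "\<lambda>l. k - l"]) auto
  then have "2 * (\<Sum>l\<le>k. real l * u l t * u (k - l) t)
      = (\<Sum>l\<le>k. real l * u l t * u (k - l) t + real (k - l) * u (k - l) t * u l t)"
    by (simp add: sum.distrib)
  also have "\<dots> = (\<Sum>l\<le>k. real k * (u l t * u (k - l) t))"
    by (rule sum.cong) (auto simp: algebra_simps of_nat_diff)
  also have "\<dots> = real k * conv k t" by (simp add: conv_def sum_distrib_left)
  finally show ?thesis by simp
qed

definition V :: "real \<Rightarrow> real" where
  "V t = integral {0..t} (u 1)"

text \<open>\<open>F\<close> stands for \<open>v\<^sub>1\<close> plus the total mass that ever left state \<open>1\<close> by coagulation.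
  Its increments are the mass of the clusters that burn.\<close>

definition F :: "real \<Rightarrow> real" where
  "F t = u 1 t + V t"

lemma V_deriv:
  assumes "0 < t" shows "(V has_real_derivative u 1 t) (at t)"
proof -
  have "((\<lambda>x. integral {0..x} (u 1)) has_real_derivative u 1 t) (at t within {0..t + 1})"
    using assms by (intro integral_has_real_derivative continuous_on_subset[OF continuous_on_u]) auto
  moreover have "at t within {0..t + 1} = at t" using assms by (intro at_within_interior) simp
  ultimately show ?thesis by (simp add: V_def[abs_def])
qed

lemma V_0 [simp]: "V 0 = 0"
  by (simp add: V_def)

lemma continuous_on_V:
  assumes "0 \<le> a" shows "continuous_on {a..b} V"
proof -
  have "continuous_on {0..b} (\<lambda>t. integral {0..t} (u 1))"
    by (intro indefinite_integral_continuous_1 integrable_continuous_interval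
        continuous_on_subset[OF continuous_on_u]) auto
  then show ?thesis using assms by (auto simp: V_def[abs_def] intro: continuous_on_subset)
qed

lemma continuous_on_u': "0 \<le> a \<Longrightarrow> continuous_on {a..b} (u k)"
  by (rule continuous_on_subset[OF continuous_on_u]) auto

lemma continuous_on_F: "0 \<le> a \<Longrightarrow> continuous_on {a..b} F"
  unfolding F_def[abs_def] by (intro continuous_intros continuous_on_u' continuous_on_V)

lemma sum_from_2: "1 \<le> n \<Longrightarrow> (\<Sum>k=2..n. f k) = (\<Sum>k\<le>n. f k) - f 0 - f (1::nat)" for f :: "nat \<Rightarrow> real"
proof -
  assume n: "1 \<le> n"
  then have "{..n} = insert 0 (insert 1 {2..n})" by auto
  then show ?thesis by simp
qed

text \<open>Up to size \<open>n\<close>, the total gain by coagulation is at most the total loss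
  times a mass that is at most 1. Hence the mass in \<open>2..n\<close> grows no faster than at the
  rate \<open>u 1\<close> at which singletons coagulate. In the limit, conservation of mass turns
  the mass of sizes at least 2 into \<open>1 - u 1\<close>.\<close>

lemma F_mono:
  assumes "0 \<le> s" "s \<le> t" shows "F s \<le> F t"
proof -
  have "(\<Sum>k\<le>n. u k t) - u 1 t - ((\<Sum>k\<le>n. u k s) - u 1 s) \<le> V t - V s" if n: "1 \<le> n" for n
  proof -
    define D where "D t = V t - (\<Sum>k=2..n. u k t)" for t
    have "D s \<le> D t"
    proof (rule DERIV_nonneg_imp_increasing_open[OF assms(2)])
      show "continuous_on {s..t} D"
        unfolding D_def by (intro continuous_intros continuous_on_V continuous_on_u' assms)
      fix x assume "s < x" "x < t"
      then have x: "0 < x" using assms by simp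
      let ?d = "u 1 x - (\<Sum>k=2..n. - real k * u k x + real k / 2 * conv k x)"
      have "(D has_real_derivative ?d) (at x)"
        unfolding D_def by (intro DERIV_diff DERIV_sum V_deriv u_deriv x) auto
      moreover have "(\<Sum>k\<le>n. real k / 2 * conv k x) \<le> (\<Sum>k\<le>n. real k * u k x) * (\<Sum>k\<le>n. u k x)"
        unfolding weighted_conv using x by (intro sum_convolution_le) (auto simp: u_nonneg)
      moreover have "(\<Sum>k\<le>n. real k * u k x) * (\<Sum>k\<le>n. u k x) \<le> (\<Sum>k\<le>n. real k * u k x)"
        using x partial_sums_u_le_1[of x "{..n}"] by (intro mult_left_le sum_nonneg) (auto simp: u_nonneg)
      ultimately show "\<exists>d. (D has_real_derivative d) (at x) \<and> 0 \<le> d"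
        using n by (intro exI[of _ ?d]) (simp add: sum_from_2 sum.distrib sum_negf sum_subtractf conv_le_1_eq_0)
    qed
    then show ?thesis using n by (simp add: D_def sum_from_2)
  qed
  then have "eventually (\<lambda>n. (\<Sum>k\<le>n. u k t) - u 1 t - ((\<Sum>k\<le>n. u k s) - u 1 s) \<le> V t - V s) sequentially"
    by (auto simp: eventually_sequentially)
  moreover have "(\<lambda>n. (\<Sum>k\<le>n. u k t) - u 1 t - ((\<Sum>k\<le>n. u k s) - u 1 s)) \<longlonglongrightarrow> 1 - u 1 t - (1 - u 1 s)"
    using u_sums[of t] u_sums[of s] assms by (intro tendsto_intros) (auto simp: sums_def_le)
  ultimately have "1 - u 1 t - (1 - u 1 s) \<le> V t - V s"
    by (intro tendsto_upperbound) auto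
  then show ?thesis by (simp add: F_def)
qed

text \<open>Dividing the equations by \<open>k\<close> leaves the mass as loss and half a
  convolution as gain. Once \<open>n\<close> captures mass \<open>3 / 4\<close> on all of
  \<open>[0, t]\<close>, the derivative of \<open>V\<close> minus the sum of \<open>u k / k\<close>
  over \<open>2..n\<close> is at least \<open>3 / 4 - 1 / 2 = 1 / 4\<close>. The \<open>- 1\<close>
  pays for the initial value of that sum.\<close>

lemma F_ge:
  assumes "0 \<le> t" shows "t / 4 - 1 \<le> F t"
proof -
  obtain K where "\<And>n x. n \<ge> K \<Longrightarrow> x \<in> {0..t} \<Longrightarrow> 3 / 4 < (\<Sum>k<n. u k x)"
    using uniform_tails[of "1 / 4" t] by fastforce
  then have "3 / 4 < (\<Sum>k\<le>Suc K. u k x)" if "x \<in> {0..t}" for x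
    using that by (metis lessThan_Suc_atMost le_SucI order_refl)
  then obtain n where n: "1 \<le> n" and K: "\<And>x. x \<in> {0..t} \<Longrightarrow> 3 / 4 < (\<Sum>k\<le>n. u k x)"
    by (metis One_nat_def Suc_le_mono zero_le)
  define D where "D t = V t - (\<Sum>k=2..n. u k t / real k) - t / 4" for t
  have "D 0 \<le> D t"
  proof (rule DERIV_nonneg_imp_increasing_open[OF assms])
    show "continuous_on {0..t} D"
      unfolding D_def by (intro continuous_intros continuous_on_V continuous_on_u') auto
    fix x assume "0 < x" "x < t"
    let ?d = "u 1 x - (\<Sum>k=2..n. (- real k * u k x + real k / 2 * conv k x) / real k) - 1 / 4"
    have "(D has_real_derivative ?d) (at x)"
      unfolding D_def by (intro DERIV_diff DERIV_sum V_deriv DERIV_cdivide u_deriv \<open>0 < x\<close>)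
        (auto intro!: derivative_eq_intros)
    moreover have "(\<Sum>k=2..n. (- real k * u k x + real k / 2 * conv k x) / real k)
        = (\<Sum>k=2..n. conv k x) / 2 - (\<Sum>k=2..n. u k x)"
      unfolding sum_divide_distrib sum_subtractf[symmetric] by (rule sum.cong) (auto simp: field_simps)
    moreover have "(\<Sum>k\<le>n. conv k x) \<le> (\<Sum>k\<le>n. u k x) * (\<Sum>k\<le>n. u k x)"
      unfolding conv_def using \<open>0 < x\<close> by (intro sum_convolution_le) (auto simp: u_nonneg)
    moreover have "(\<Sum>k\<le>n. u k x) * (\<Sum>k\<le>n. u k x) \<le> 1"
      using \<open>0 < x\<close> by (intro mult_le_one partial_sums_u_le_1 sum_nonneg) (auto simp: u_nonneg)
    moreover have "3 / 4 < (\<Sum>k\<le>n. u k x)" using \<open>0 < x\<close> \<open>x < t\<close> by (intro K) auto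
    ultimately show "\<exists>d. (D has_real_derivative d) (at x) \<and> 0 \<le> d"
      by (intro exI[of _ ?d])
        (simp add: sum_from_2[OF n] conv_le_1_eq_0)
  qed
  moreover have "(\<Sum>k=2..n. u k 0 / real k) \<le> 1"
  proof -
    have "(\<Sum>k=2..n. u k 0 / real k) \<le> (\<Sum>k=2..n. u k 0)"
    proof (rule sum_mono)
      fix k assume "k \<in> {2..n}"
      then show "u k 0 / real k \<le> u k 0"
        using u_nonneg[of 0 k] mult_right_mono[of 1 "real k" "u k 0"] by (simp add: field_simps)
    qed
    then show ?thesis using partial_sums_u_le_1[of 0 "{2..n}"] by simp
  qed
  moreover have "0 \<le> (\<Sum>k=2..n. u k t / real k)"
    using assms by (intro sum_nonneg) (auto simp: u_nonneg)
  moreover have "0 \<le> u 1 t" using assms by (rule u_nonneg)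
  ultimately show ?thesis by (simp add: D_def F_def)
qed

text \<open>The loss term combines with the growth of \<open>z ^ k\<close> to
  \<open>- k * u k * z ^ k * X\<close>, and over all \<open>k\<close> this would cancel the gain.
  Since \<open>k = 1\<close> has no equation and is left out, \<open>z * u 1 * X\<close> remains.
  The bound \<open>r < 1\<close> makes the weights \<open>k * r ^ k\<close> summable, which
  justifies termwise differentiation.\<close>

lemma X_along_flow_deriv:
  assumes ab: "0 < a" "a < t" "t < b" and r: "r < 1"
    and z: "\<And>s. s \<in> {a..b} \<Longrightarrow> (z has_real_derivative z s * (1 - X s (z s))) (at s)"
      "\<And>s. s \<in> {a..b} \<Longrightarrow> 0 \<le> z s \<and> z s \<le> r"
  shows "((\<lambda>s. X s (z s) - z s * u 1 s) has_real_derivative z t * u 1 t * X t (z t)) (at t)"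
proof -
  define f where "f k s = (if k \<le> 1 then 0 else u k s * z s ^ k)" for k s
  define f' where "f' k s = (if k \<le> 1 then 0 else
      real k / 2 * conv k s * z s ^ k - real k * u k s * z s ^ k * X s (z s))" for k s
  have t: "t \<in> {a..b}" "0 < t" using ab by auto
  have "0 \<le> r" using z(2)[OF t(1)] by linarith
  have z01: "0 \<le> z s" "z s \<le> 1" "0 < s" if "s \<in> {a..b}" for s
    using z(2)[OF that] r ab that by auto
  have weight: "summable (\<lambda>k. real k * r ^ k)"
  proof -
    have "summable (\<lambda>k. r * (real (Suc k) * r ^ k))"
      using geometric_deriv_sums[of r] \<open>0 \<le> r\<close> r by (intro summable_mult) (auto simp: sums_iff)
    then have "summable (\<lambda>k. real (Suc k) * r ^ Suc k)" by (simp add: mult_ac)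
    then show ?thesis by (subst summable_Suc_iff[symmetric])
  qed
  have deriv: "(f k has_real_derivative f' k s) (at s)" if s: "s \<in> {a..b}" for k s
  proof (cases "k \<le> 1")
    case False
    have "((\<lambda>s. u k s * z s ^ k) has_real_derivative
        (- real k * u k s + real k / 2 * conv k s) * z s ^ k
        + real k * (z s * (1 - X s (z s))) * z s ^ (k - 1) * u k s) (at s)"
      using False z01[OF s] by (auto intro!: derivative_eq_intros u_deriv z(1)[OF s])
    moreover have "(- real k * u k s + real k / 2 * conv k s) * z s ^ k
        + real k * (z s * (1 - X s (z s))) * z s ^ (k - 1) * u k s
        = (- real k * u k s + real k / 2 * conv k s) * z s ^ k
        + real k * (1 - X s (z s)) * u k s * (z s ^ (k - 1) * z s)" by simp
    moreover have "z s ^ (k - 1) * z s = z s ^ k" using False power_minus_mult[of k "z s"] by simp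
    moreover have "(- real k * u k s + real k / 2 * conv k s) * z s ^ k
        + real k * (1 - X s (z s)) * u k s * z s ^ k = f' k s"
      using False by (simp add: f'_def algebra_simps)
    moreover have "f k = (\<lambda>s. u k s * z s ^ k)" using False by (simp add: f_def[abs_def])
    ultimately show ?thesis by metis
  qed (simp add: f_def[abs_def] f'_def)
  have bound: "norm (f' k s) \<le> 2 * (real k * r ^ k)" if s: "s \<in> {a..b}" for k s
  proof -
    have zk: "0 \<le> z s ^ k" "z s ^ k \<le> r ^ k" using z(2)[OF s] by (auto intro: power_mono)
    have "u k s * X s (z s) \<le> 1"
      using z01[OF s] by (intro mult_le_one u_le_1 X_nonneg X_le_1) auto
    moreover have "0 \<le> u k s * X s (z s)"
      using z01[OF s] by (intro mult_nonneg_nonneg u_nonneg X_nonneg) auto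
    moreover have "0 \<le> conv k s" "conv k s \<le> 1"
      using z01[OF s] by (auto intro: conv_nonneg conv_le_1)
    ultimately have "\<bar>conv k s / 2 - u k s * X s (z s)\<bar> \<le> 2" by linarith
    then have "\<bar>conv k s / 2 - u k s * X s (z s)\<bar> * (real k * z s ^ k) \<le> 2 * (real k * r ^ k)"
      using zk by (intro mult_mono) auto
    moreover have "\<bar>conv k s / 2 - u k s * X s (z s)\<bar> * (real k * z s ^ k)
        = \<bar>real k / 2 * conv k s * z s ^ k - real k * u k s * z s ^ k * X s (z s)\<bar>"
    proof -
      have "real k / 2 * conv k s * z s ^ k - real k * u k s * z s ^ k * X s (z s)
          = (conv k s / 2 - u k s * X s (z s)) * (real k * z s ^ k)" by (simp add: algebra_simps)
      then show ?thesis using zk by (simp add: abs_mult)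
    qed
    ultimately show ?thesis using \<open>0 \<le> r\<close> by (simp add: f'_def)
  qed
  have f_sums: "(\<lambda>k. f k s) sums (X s (z s) - z s * u 1 s)" if s: "s \<in> {a..b}" for s
  proof -
    have "(\<lambda>k. u k s * z s ^ k - (if k = 1 then u 1 s * z s else 0)) sums (X s (z s) - u 1 s * z s)"
      using z01[OF s] by (intro sums_diff X_sums sums_single) auto
    moreover have "(\<lambda>k. u k s * z s ^ k - (if k = 1 then u 1 s * z s else 0)) = (\<lambda>k. f k s)"
      by (auto simp: f_def fun_eq_iff le_Suc_eq)
    ultimately show ?thesis by (simp add: mult.commute)
  qed
  have "((\<lambda>s. \<Sum>k. f k s) has_real_derivative (\<Sum>k. f' k t)) (at t)"
  proof (rule has_field_derivative_series'(2))
    show "uniformly_convergent_on {a..b} (\<lambda>n s. \<Sum>k<n. f' k s)"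
      using bound weight by (intro Weierstrass_m_test'[of _ _ "\<lambda>k. 2 * (real k * r ^ k)"] summable_mult)
    show "summable (\<lambda>k. f k t)" using f_sums[OF t(1)] by (rule sums_summable)
    show "t \<in> interior {a..b}" using ab by simp
  qed (use deriv t in \<open>auto intro: has_field_derivative_at_within\<close>)
  moreover have "eventually (\<lambda>s. (\<Sum>k. f k s) = X s (z s) - z s * u 1 s) (nhds t)"
    using eventually_nhds_in_open[of "{a<..<b}" t] ab
    by (auto elim!: eventually_mono simp: sums_unique[OF f_sums, symmetric])
  ultimately have main: "((\<lambda>s. X s (z s) - z s * u 1 s) has_real_derivative (\<Sum>k. f' k t)) (at t)"
    by (subst (asm) DERIV_cong_ev) auto
  have "(\<lambda>k. f' k t) sums (z t * u 1 t * X t (z t))"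
  proof -
    \<comment> \<open>\<open>P\<close> is \<open>z\<close> times the z-derivative of
      \<open>X\<close>; the gain terms are its Cauchy product with the series of
      \<open>X\<close>.\<close>
    define P where "P = (\<Sum>k. real k * u k t * z t ^ k)"
    have nP: "summable (\<lambda>k. norm (real k * u k t * z t ^ k))"
    proof (rule summable_comparison_test[OF _ weight])
      have "norm (norm (real k * u k t * z t ^ k)) \<le> real k * r ^ k" for k
        using z01[OF t(1)] z(2)[OF t(1)] u_nonneg[of t k] u_le_1[of t k]
          mult_mono[of "u k t" 1 "z t ^ k" "r ^ k"] power_mono[of "z t" r k]
        by (simp add: abs_mult power_abs mult.assoc mult_left_mono)
      then show "\<exists>N. \<forall>k\<ge>N. norm (norm (real k * u k t * z t ^ k)) \<le> real k * r ^ k" by blast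
    qed
    have "(\<lambda>k. \<Sum>l\<le>k. (real l * u l t * z t ^ l) * (u (k - l) t * z t ^ (k - l))) sums
        (P * (\<Sum>k. u k t * z t ^ k))"
      unfolding P_def using nP z01[OF t(1)] by (intro Cauchy_product_sums summable_u_power) auto
    also have "(\<Sum>k. u k t * z t ^ k) = X t (z t)"
      using z01[OF t(1)] by (intro sums_unique[symmetric] X_sums) auto
    finally have "(\<lambda>k. \<Sum>l\<le>k. (real l * u l t * z t ^ l) * (u (k - l) t * z t ^ (k - l))) sums (P * X t (z t))" .
    moreover have "(\<Sum>l\<le>k. (real l * u l t * z t ^ l) * (u (k - l) t * z t ^ (k - l)))
        = real k / 2 * conv k t * z t ^ k" for k
    proof -
      have "(real l * u l t * z t ^ l) * (u (k - l) t * z t ^ (k - l))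
          = real l * u l t * u (k - l) t * z t ^ k" if "l \<le> k" for l
        using that by (simp add: power_add[symmetric] mult_ac)
      then show ?thesis unfolding weighted_conv sum_distrib_right by (intro sum.cong) auto
    qed
    ultimately have "(\<lambda>k. real k / 2 * conv k t * z t ^ k) sums (P * X t (z t))"
      by (metis (no_types, lifting) sums_cong)
    moreover have "(\<lambda>k. real k * u k t * z t ^ k * X t (z t)) sums (P * X t (z t))"
      unfolding P_def by (intro sums_mult2 summable_sums summable_norm_cancel[OF nP])
    moreover have "(\<lambda>k. if k = 1 then z t * u 1 t * X t (z t) else 0) sums (z t * u 1 t * X t (z t))"
      by (rule sums_single)
    ultimately have "(\<lambda>k. real k / 2 * conv k t * z t ^ k - real k * u k t * z t ^ k * X t (z t)
        + (if k = 1 then z t * u 1 t * X t (z t) else 0)) sums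
        (P * X t (z t) - P * X t (z t) + z t * u 1 t * X t (z t))"
      by (intro sums_add sums_diff)
    moreover have "(\<lambda>k. real k / 2 * conv k t * z t ^ k - real k * u k t * z t ^ k * X t (z t)
        + (if k = 1 then z t * u 1 t * X t (z t) else 0)) = (\<lambda>k. f' k t)"
      by (auto simp: f'_def fun_eq_iff le_Suc_eq conv_le_1_eq_0)
    ultimately show ?thesis by simp
  qed
  then show ?thesis using main by (simp add: sums_iff)
qed

section \<open>Characteristic curves\<close>

lemma curve_range:
  assumes "characteristic_curve v y z" "0 \<le> t" shows "0 < z t" "z t \<le> 1"
  using assms by (auto simp: characteristic_curve_def)

lemma curve_eq_1: "characteristic_curve v y z \<Longrightarrow> 0 \<le> t \<Longrightarrow> y \<le> t \<Longrightarrow> z t = 1"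
  by (auto simp: characteristic_curve_def)

lemma curve_less_1: "characteristic_curve v y z \<Longrightarrow> 0 \<le> t \<Longrightarrow> t < y \<Longrightarrow> z t < 1"
  by (auto simp: characteristic_curve_def)

lemma curve_deriv:
  "characteristic_curve v y z \<Longrightarrow> 0 < t \<Longrightarrow> (z has_real_derivative z t * (1 - X t (z t))) (at t)"
  by (auto simp: characteristic_curve_def)

lemma continuous_on_curve: "characteristic_curve v y z \<Longrightarrow> 0 \<le> a \<Longrightarrow> continuous_on {a..b} z"
  by (auto simp: characteristic_curve_def intro: continuous_on_subset)

lemma X_curve_le_1: "characteristic_curve v y z \<Longrightarrow> 0 \<le> t \<Longrightarrow> X t (z t) \<le> 1"
  using curve_range by (intro X_le_1) (auto intro: less_imp_le)

lemma continuous_on_X_curve: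
  "characteristic_curve v y z \<Longrightarrow> 0 \<le> a \<Longrightarrow> continuous_on {a..b} (\<lambda>s. X s (z s))"
  using curve_range by (intro continuous_on_X continuous_on_curve) (auto intro: less_imp_le)

lemma curve_mono:
  assumes c: "characteristic_curve v y z" and "0 \<le> s" "s \<le> t" shows "z s \<le> z t"
proof (rule DERIV_nonneg_imp_increasing_open[OF assms(3)])
  show "continuous_on {s..t} z" using c assms(2) by (rule continuous_on_curve)
  fix x assume "s < x" "x < t"
  then have "0 < x" using assms by simp
  then show "\<exists>d. (z has_real_derivative d) (at x) \<and> 0 \<le> d"
    using curve_deriv[OF c] curve_range(1)[OF c, of x] X_curve_le_1[OF c, of x]
    by (intro exI[of _ "z x * (1 - X x (z x))"]) auto
qed

text \<open>Subtracting also \<open>z * V\<close> absorbs the remainder \<open>z * u 1 * X\<close>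
  of the transport identity and moves the derivative from \<open>F\<close> to
  \<open>z\<close>.\<close>

lemma curve_X_deriv:
  assumes c: "characteristic_curve v y z" and t: "0 < t" "t < y"
  shows "((\<lambda>s. X s (z s) - z s * F s) has_real_derivative - (z t * (1 - X t (z t))) * F t) (at t)"
proof -
  \<comment> \<open>A time strictly before \<open>y\<close>, where the curve is still below 1: this
    supplies the bound \<open>r = z b\<close>.\<close>
  define b where "b = (t + y) / 2"
  have "((\<lambda>s. X s (z s) - z s * u 1 s) has_real_derivative z t * u 1 t * X t (z t)) (at t)"
  proof (rule X_along_flow_deriv[of "t / 2" t b "z b"])
    show "0 \<le> z s \<and> z s \<le> z b" if "s \<in> {t / 2..b}" for s
      using that t curve_range(1)[OF c, of s] curve_mono[OF c, of s b] by auto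
    show "z b < 1" using t by (intro curve_less_1[OF c]) (auto simp: b_def)
  qed (use t in \<open>auto simp: b_def intro: curve_deriv[OF c]\<close>)
  then have "((\<lambda>s. X s (z s) - z s * u 1 s - z s * V s) has_real_derivative
      z t * u 1 t * X t (z t) - (z t * (1 - X t (z t)) * V t + u 1 t * z t)) (at t)"
    by (intro DERIV_diff DERIV_mult curve_deriv[OF c] V_deriv t)
  then show ?thesis by (simp add: F_def algebra_simps)
qed

text \<open>Integration by parts with \<open>\<eta> = z - c\<close>, which stays nonnegative because
  the curve is nondecreasing.\<close>

lemma curve_X_minus_F_mono:
  assumes c: "characteristic_curve v y z" and ab: "0 \<le> a" "a \<le> b" "b \<le> y" and "c \<le> z a"
  shows "X a (z a) - c * F a \<le> X b (z b) - c * F b"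
proof -
  have "X a (z a) - z a * F a + (z a - c) * F a \<le> X b (z b) - z b * F b + (z b - c) * F b"
  proof (rule integration_by_parts_mono[where \<eta>' = "\<lambda>s. z s * (1 - X s (z s))"
        and H = "\<lambda>s. X s (z s) - z s * F s" and \<eta> = "\<lambda>s. z s - c" and F = F, OF ab(2)])
    fix s assume s: "a < s" "s < b"
    then show "((\<lambda>s. X s (z s) - z s * F s) has_real_derivative - (z s * (1 - X s (z s))) * F s) (at s)"
      using ab by (intro curve_X_deriv[OF c]) auto
    show "((\<lambda>s. z s - c) has_real_derivative z s * (1 - X s (z s))) (at s)"
      using curve_deriv[OF c, of s] s ab by (auto intro!: derivative_eq_intros)
  next
    fix s assume "a \<le> s" "s \<le> b"
    then show "0 \<le> z s - c" using curve_mono[OF c, of a s] ab \<open>c \<le> z a\<close> by simp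
  qed (use ab F_mono in \<open>auto intro!: continuous_intros continuous_on_X_curve[OF c] continuous_on_curve[OF c] continuous_on_F\<close>)
  then show ?thesis by (simp add: algebra_simps)
qed

lemma curve_X_mono:
  "characteristic_curve v y z \<Longrightarrow> 0 \<le> a \<Longrightarrow> a \<le> b \<Longrightarrow> b \<le> y \<Longrightarrow> X a (z a) \<le> X b (z b)"
  using curve_X_minus_F_mono[of y z a b 0] curve_range(1)[of y z a] by simp

text \<open>In the difference of the two identities, \<open>F\<close> enters with the factor
  \<open>z - w\<close>, whose sign is the order of the curves.\<close>

lemma curve_X_diff_mono:
  assumes c: "characteristic_curve v y z" "characteristic_curve v y' w"
    and ab: "0 \<le> a" "a \<le> b" "b \<le> y" "b \<le> y'"
    and le: "\<And>s. a \<le> s \<Longrightarrow> s \<le> b \<Longrightarrow> w s \<le> z s"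
  shows "X a (z a) - X a (w a) \<le> X b (z b) - X b (w b)"
proof -
  let ?H = "\<lambda>s. (X s (z s) - z s * F s) - (X s (w s) - w s * F s)"
  have "?H a + (z a - w a) * F a \<le> ?H b + (z b - w b) * F b"
  proof (rule integration_by_parts_mono[where \<eta>' = "\<lambda>s. z s * (1 - X s (z s)) - w s * (1 - X s (w s))"
        and H = ?H and \<eta> = "\<lambda>s. z s - w s" and F = F, OF ab(2)])
    fix s assume s: "a < s" "s < b"
    have "(?H has_real_derivative - (z s * (1 - X s (z s))) * F s - - (w s * (1 - X s (w s))) * F s) (at s)"
      using ab s by (intro DERIV_diff curve_X_deriv[OF c(1)] curve_X_deriv[OF c(2)]) auto
    then show "(?H has_real_derivative - (z s * (1 - X s (z s)) - w s * (1 - X s (w s))) * F s) (at s)"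
      by (simp add: algebra_simps)
    show "((\<lambda>s. z s - w s) has_real_derivative z s * (1 - X s (z s)) - w s * (1 - X s (w s))) (at s)"
      using s ab by (intro DERIV_diff curve_deriv[OF c(1)] curve_deriv[OF c(2)]) auto
  qed (use ab F_mono le in \<open>auto intro!: continuous_intros continuous_on_X_curve[OF c(1)] continuous_on_curve[OF c(1)]
      continuous_on_X_curve[OF c(2)] continuous_on_curve[OF c(2)] continuous_on_F\<close>)
  then show ?thesis by (simp add: algebra_simps)
qed

lemma curve_times_F_le:
  assumes c: "characteristic_curve v y z" and t: "0 \<le> t" "t \<le> y"
  shows "z t * (F y - F t) \<le> 1"
proof -
  have "X t (z t) - z t * F t \<le> X y (z y) - z t * F y"
    using t by (intro curve_X_minus_F_mono[OF c]) auto
  moreover have "X y (z y) \<le> 1" "0 \<le> X t (z t)"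
    using t curve_range[OF c, of t] by (auto intro: X_curve_le_1[OF c] X_nonneg)
  ultimately show ?thesis by (simp add: algebra_simps)
qed

text \<open>If the later curve were above at \<open>t\<close>, the two would meet at a first time
  \<open>Inf S\<close>, at the latest at \<open>y\<close>, where the earlier one is 1. Until then
  the gap between the values of \<open>X\<close> cannot shrink, yet it is positive at
  \<open>t\<close> and zero at the meeting.\<close>

lemma curve_antimono:
  assumes c: "characteristic_curve v y z" "characteristic_curve v y' w" and "y < y'" "0 \<le> t"
  shows "w t \<le> z t"
proof (rule ccontr)
  assume "\<not> w t \<le> z t"
  then have lt: "z t < w t" by simp
  have "t < y"
  proof (rule ccontr)
    assume "\<not> t < y"
    then show False using lt curve_eq_1[OF c(1), of t] curve_range[OF c(2), of t] \<open>0 \<le> t\<close> by simp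
  qed
  define S where "S = {s\<in>{t..y}. w s \<le> z s}"
  have cont: "continuous_on {t..y} z" "continuous_on {t..y} w"
    using c \<open>0 \<le> t\<close> by (auto intro: continuous_on_curve)
  have "closed S" unfolding S_def by (intro continuous_on_closed_Collect_le cont closed_atLeastAtMost)
  moreover have "y \<in> S"
    using \<open>0 \<le> t\<close> \<open>t < y\<close> \<open>y < y'\<close> curve_eq_1[OF c(1), of y] curve_range[OF c(2), of y] by (auto simp: S_def)
  moreover have "bounded S" by (rule bounded_subset[of "{t..y}"]) (auto simp: S_def)
  ultimately have b: "Inf S \<in> S" and low: "\<And>s. s \<in> S \<Longrightarrow> Inf S \<le> s"
    by (auto intro!: closed_contains_Inf cInf_lower bounded_imp_bdd_below)
  have tb: "t \<le> Inf S" "Inf S \<le> y" using b by (auto simp: S_def)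
  have less: "z s < w s" if "t \<le> s" "s < Inf S" for s
  proof (rule ccontr)
    assume "\<not> z s < w s"
    then have "s \<in> S" using that tb by (simp add: S_def)
    then show False using low[of s] that by simp
  qed
  have wb: "w (Inf S) \<le> z (Inf S)" using b by (simp add: S_def)
  have "t \<noteq> Inf S"
  proof
    assume "t = Inf S"
    then show False using wb lt by simp
  qed
  then have tS: "t < Inf S" using tb by simp
  have "z (Inf S) \<le> w (Inf S)"
  proof (rule tendsto_le[of "at_left (Inf S)"])
    have "{t..Inf S} \<subseteq> {t..y}" using tb by simp
    then show "(z \<longlongrightarrow> z (Inf S)) (at_left (Inf S))" "(w \<longlongrightarrow> w (Inf S)) (at_left (Inf S))"
      using continuous_on_subset[OF cont(1)] continuous_on_subset[OF cont(2)]
      by (intro continuous_on_Icc_at_leftD[OF _ tS]; simp)+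
    show "eventually (\<lambda>s. z s \<le> w s) (at_left (Inf S))"
      using eventually_at_left_real[OF tS]
    proof eventually_elim
      case (elim s)
      then show ?case using less[of s] by simp
    qed
  qed simp
  then have eq: "z (Inf S) = w (Inf S)" using wb by simp
  have "X t (w t) - X t (z t) \<le> X (Inf S) (w (Inf S)) - X (Inf S) (z (Inf S))"
  proof (rule curve_X_diff_mono[OF c(2,1)])
    show "z s \<le> w s" if "t \<le> s" "s \<le> Inf S" for s
    proof (cases "s = Inf S")
      case False
      then show ?thesis using that less[of s] by simp
    qed (use eq in simp)
  qed (use tb \<open>0 \<le> t\<close> \<open>y < y'\<close> in auto)
  moreover have "X t (z t) < X t (w t)"
    using lt curve_range[OF c(1), of t] curve_range[OF c(2), of t] \<open>0 \<le> t\<close> by (intro X_strict_mono) auto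
  ultimately show False unfolding eq by simp
qed

lemma curve_increment_le:
  assumes c: "characteristic_curve v y z" and "0 \<le> s" "s \<le> t"
  shows "z t - z s \<le> t - s"
proof -
  have "s - z s \<le> t - z t"
  proof (rule DERIV_nonneg_imp_increasing_open[OF assms(3)])
    show "continuous_on {s..t} (\<lambda>s. s - z s)"
      using continuous_on_curve[OF c assms(2)] by (intro continuous_intros)
    fix x assume "s < x" "x < t"
    then have x: "0 < x" using assms by simp
    have "z x * (1 - X x (z x)) \<le> 1"
      using curve_range[OF c, of x] x X_curve_le_1[OF c, of x] X_nonneg[of x "z x"] by (intro mult_le_one) auto
    then show "\<exists>d. ((\<lambda>s. s - z s) has_real_derivative d) (at x) \<and> 0 \<le> d"
      using curve_deriv[OF c x] by (intro exI[of _ "1 - z x * (1 - X x (z x))"]) (auto intro!: derivative_intros)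
  qed
  then show ?thesis by simp
qed

lemma F_at_top: "filterlim F at_top at_top"
proof (rule filterlim_at_top_mono)
  show "filterlim (\<lambda>t. t / 4 - 1 :: real) at_top at_top" by real_asymp
  show "eventually (\<lambda>t. t / 4 - 1 \<le> F t) at_top"
    using eventually_mono[OF eventually_ge_at_top[of 0] F_ge] .
qed

lemma curves_tendsto_0:
  assumes c: "\<And>y. y0 < y \<Longrightarrow> characteristic_curve v y (\<psi> y)" and t: "0 \<le> t"
  shows "((\<lambda>y. \<psi> y t) \<longlongrightarrow> 0) at_top"
proof (rule tendsto_sandwich)
  show "((\<lambda>_. 0::real) \<longlongrightarrow> 0) at_top" by simp
  have "filterlim (\<lambda>y. F y - F t) at_top at_top"
    using filterlim_tendsto_add_at_top[OF tendsto_const F_at_top, of "- F t"] by simp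
  then show "((\<lambda>y. inverse (F y - F t)) \<longlongrightarrow> 0) at_top"
    by (rule tendsto_inverse_0_at_top)
  have "eventually (\<lambda>y. 0 < F y - F t \<and> y0 < y \<and> t \<le> y) at_top"
    using \<open>filterlim (\<lambda>y. F y - F t) at_top at_top\<close>[unfolded filterlim_at_top_dense, rule_format, of 0]
    by (intro eventually_conj eventually_ge_at_top eventually_gt_at_top)
  then show "eventually (\<lambda>y. \<psi> y t \<le> inverse (F y - F t)) at_top"
  proof eventually_elim
    case (elim y)
    then have "\<psi> y t * (F y - F t) \<le> 1" using t by (intro curve_times_F_le c) auto
    then show ?case using elim by (simp add: field_simps)
  qed
  show "eventually (\<lambda>y. 0 \<le> \<psi> y t) at_top"
    using eventually_mono[OF eventually_gt_at_top[of y0] less_imp_le[OF curve_range(1)[OF c t]]] .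
qed

text \<open>The gap at time \<open>t\<close> is at most the gap at the later time \<open>y\<close>,
  when \<open>\<psi> y\<close> has just reached 1. A curve ending at \<open>y' > y\<close> grows at
  most at unit speed, so at \<open>y\<close> it is within \<open>y' - y\<close> of 1, and uniform
  continuity of \<open>X\<close> in \<open>z\<close> applies. The condition \<open>t <= a\<close>
  ensures that no curve ends before \<open>t\<close>.\<close>

lemma continuous_on_X_curves:
  assumes c: "\<And>y. y0 < y \<Longrightarrow> characteristic_curve v y (\<psi> y)"
    and t: "0 \<le> t" "t \<le> a" "y0 < a"
  shows "continuous_on {a..b} (\<lambda>y. X t (\<psi> y t))"
proof -
  have "\<exists>d>0. \<forall>y\<in>{a..b}. \<forall>y'\<in>{a..b}. dist y' y < d \<longrightarrow> dist (X t (\<psi> y' t)) (X t (\<psi> y t)) < e" if "0 < e" for e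
  proof -
    obtain d where d: "0 < d" "\<And>y z w. y \<in> {0..b} \<Longrightarrow> z \<in> {0..1} \<Longrightarrow> w \<in> {0..1} \<Longrightarrow> \<bar>z - w\<bar> \<le> d \<Longrightarrow> \<bar>X y z - X y w\<bar> \<le> e / 2"
      using X_uniformly_continuous[of "e / 2" b] \<open>0 < e\<close> by (metis half_gt_zero)
    have main: "dist (X t (\<psi> y' t)) (X t (\<psi> y t)) < e"
      if y: "y \<in> {a..b}" "y' \<in> {a..b}" "y < y'" "y' - y < d" for y y'
    proof -
      have cy: "characteristic_curve v y (\<psi> y)" "characteristic_curve v y' (\<psi> y')" using y t by (auto intro: c)
      have "0 \<le> y" "t \<le> y" using y t by auto
      have "X t (\<psi> y t) - X t (\<psi> y' t) \<le> X y (\<psi> y y) - X y (\<psi> y' y)"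
        using y t by (intro curve_X_diff_mono[OF cy] curve_antimono[OF cy]) auto
      also have "\<dots> \<le> e / 2"
      proof -
        have "\<bar>\<psi> y y - \<psi> y' y\<bar> \<le> d"
          using curve_increment_le[OF cy(2), of y y'] curve_eq_1[OF cy(1), of y] curve_eq_1[OF cy(2), of y']
            curve_range[OF cy(2), of y] y \<open>0 \<le> y\<close> by auto
        then have "\<bar>X y (\<psi> y y) - X y (\<psi> y' y)\<bar> \<le> e / 2"
          using y \<open>0 \<le> y\<close> curve_range[OF cy(1), of y] curve_range[OF cy(2), of y] by (intro d(2)) auto
        then show ?thesis by linarith
      qed
      finally have "X t (\<psi> y t) - X t (\<psi> y' t) \<le> e / 2" .
      moreover have "X t (\<psi> y' t) \<le> X t (\<psi> y t)"
        using curve_antimono[OF cy y(3) t(1)] curve_range[OF cy(1) t(1)] curve_range[OF cy(2) t(1)] t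
        by (intro X_mono) auto
      ultimately show ?thesis using \<open>0 < e\<close> by (simp add: dist_real_def)
    qed
    have "dist (X t (\<psi> y' t)) (X t (\<psi> y t)) < e" if "y \<in> {a..b}" "y' \<in> {a..b}" "dist y' y < d" for y y'
      using main[of y y'] main[of y' y] that \<open>0 < e\<close>
      by (cases y y' rule: linorder_cases) (auto simp: dist_real_def abs_minus_commute)
    then show ?thesis using d(1) by blast
  qed
  then show ?thesis unfolding continuous_on_iff by meson
qed

section \<open>Curves ending shortly after gelation, and the filling property\<close>

lemma initial_mean:
  shows "summable (\<lambda>k. real k * u k 0)" "T_gel v0 = inverse (\<Sum>k. real k * u k 0)"
    "1 \<le> (\<Sum>k. real k * u k 0)"
proof -
  have v0: "u k 0 = v0 k" if "k \<ge> 1" for k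
    using sol that by (auto simp: u_def critical_forest_fire_solution_def)
  have "(\<lambda>l. real l ^ 3 * v0 l) summable_on {1..}" using init by (auto simp: admissible_initial_def)
  then have "(\<lambda>l. real l * v0 l) summable_on {1..}"
  proof (rule summable_on_comparison_test)
    fix l :: nat assume l: "l \<in> {1..}"
    then have "real l ^ 1 \<le> real l ^ 3" by (intro power_increasing) auto
    then show "real l * v0 l \<le> real l ^ 3 * v0 l" "0 \<le> real l * v0 l"
      using l init by (auto simp: admissible_initial_def intro!: mult_right_mono)
  qed
  then have hs: "((\<lambda>l. real l * v0 l) has_sum (\<Sum>\<^sub>\<infinity>l\<in>{1..}. real l * v0 l)) {1..}" by (rule has_sum_infsum)
  then have "((\<lambda>l. real l * u l 0) has_sum (\<Sum>\<^sub>\<infinity>l\<in>{1..}. real l * v0 l)) UNIV"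
    by (rule has_sum_cong_neutral[THEN iffD1, rotated -1]) (auto simp: v0)
  then have sums: "(\<lambda>l. real l * u l 0) sums (\<Sum>\<^sub>\<infinity>l\<in>{1..}. real l * v0 l)" by (rule has_sum_imp_sums)
  show "summable (\<lambda>k. real k * u k 0)" using sums by (rule sums_summable)
  show "T_gel v0 = inverse (\<Sum>k. real k * u k 0)" using sums_unique[OF sums] by (simp add: T_gel_def)
  show "1 \<le> (\<Sum>k. real k * u k 0)"
  proof -
    have "u k 0 \<le> real k * u k 0" for k
      using u_nonneg[of 0 k] mult_right_mono[of 1 "real k" "u k 0"] by (cases k) auto
    then show ?thesis using sums_le[OF _ u_sums[of 0] summable_sums[OF sums_summable[OF sums]]] by simp
  qed
qed

lemma T_gel_pos: "0 < T_gel v0"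
  using initial_mean(2,3) by simp

text \<open>Bernoulli's inequality, summed: the right-hand side lies above the tangent at 1, whose
  slope is the initial mean.\<close>

lemma X_0_ge:
  assumes "0 \<le> q" "q \<le> 1" shows "1 - q / T_gel v0 \<le> X 0 (1 - q)"
proof -
  have "(\<lambda>k. u k 0 - q * (real k * u k 0)) sums (1 - q * (\<Sum>k. real k * u k 0))"
    by (intro sums_diff sums_mult u_sums summable_sums initial_mean) auto
  moreover have "(\<lambda>k. u k 0 * (1 - q) ^ k) sums X 0 (1 - q)" using assms by (intro X_sums) auto
  moreover have "u k 0 - q * (real k * u k 0) \<le> u k 0 * (1 - q) ^ k" for k
    using mult_left_mono[OF Bernoulli_inequality[of "- q" k] u_nonneg[of 0 k]] assms
    by (simp add: algebra_simps)
  ultimately have "1 - q * (\<Sum>k. real k * u k 0) \<le> X 0 (1 - q)" by (rule sums_le[rotated])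
  then show ?thesis using initial_mean(2) by (simp add: field_simps)
qed

text \<open>Put \<open>q = 1 - z 0\<close>. The logarithm of \<open>z\<close> climbs by
  \<open>- ln (1 - q)\<close> before \<open>y\<close>, at a rate \<open>1 - X\<close> that is
  largest at time 0 and at most \<open>q / T_gel v0\<close> there. To first order in
  \<open>q\<close> this only says \<open>y >= T_gel v0\<close>; the quadratic term in
  \<open>q + q^2 / 2 <= - ln (1 - q)\<close> is what bounds \<open>q\<close>.\<close>

lemma curve_0_near_1:
  assumes c: "characteristic_curve v y z" and y: "T_gel v0 < y"
  shows "1 - z 0 \<le> 2 * (y / T_gel v0 - 1)"
proof -
  define q where "q = 1 - z 0"
  have q: "0 < q" "q < 1"
    using curve_range(1)[OF c, of 0] curve_less_1[OF c, of 0] y T_gel_pos by (auto simp: q_def)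
  have "0 < y" using y T_gel_pos by simp
  define D where "D s = (1 - X 0 (z 0)) * s - ln (z s)" for s
  have "D 0 \<le> D y"
  proof (rule DERIV_nonneg_imp_increasing_open[where f = D])
    have "z x \<noteq> 0" if "0 \<le> x" for x using curve_range(1)[OF c that] by simp
    then show "continuous_on {0..y} D"
      unfolding D_def by (intro continuous_intros continuous_on_curve[OF c]) auto
    fix x assume x: "0 < x" "x < y"
    have "(D has_real_derivative (1 - X 0 (z 0)) - (1 - X x (z x))) (at x)"
      unfolding D_def using curve_range(1)[OF c, of x] x
      by (auto intro!: derivative_eq_intros curve_deriv[OF c] simp: field_simps)
    moreover have "X 0 (z 0) \<le> X x (z x)" using x by (intro curve_X_mono[OF c]) auto
    ultimately show "\<exists>d. (D has_real_derivative d) (at x) \<and> 0 \<le> d" by (intro exI) auto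
  qed (use \<open>0 < y\<close> in simp)
  then have "- ln (1 - q) \<le> (1 - X 0 (1 - q)) * y"
    using curve_eq_1[OF c, of y] \<open>0 < y\<close> by (simp add: D_def q_def)
  also have "\<dots> \<le> q / T_gel v0 * y"
    using X_0_ge[of q] q \<open>0 < y\<close> by (intro mult_right_mono) auto
  finally have "- ln (1 - q) \<le> q / T_gel v0 * y" .
  moreover have "q + q\<^sup>2 / 2 \<le> - ln (1 - q)"
  proof -
    define G where "G x = - ln (1 - x) - x - x\<^sup>2 / 2" for x :: real
    have "G 0 \<le> G q"
    proof (rule DERIV_nonneg_imp_increasing_open[where f = G])
      show "continuous_on {0..q} G" unfolding G_def using q by (intro continuous_intros) auto
      fix x assume x: "0 < x" "x < q"
      have "(G has_real_derivative 1 / (1 - x) - 1 - x) (at x)"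
        unfolding G_def using x q by (auto intro!: derivative_eq_intros)
      moreover have "(1 + x) * (1 - x) \<le> 1" by (simp add: algebra_simps)
      then have "1 + x \<le> 1 / (1 - x)" using x q by (simp add: field_simps)
      ultimately show "\<exists>d. (G has_real_derivative d) (at x) \<and> 0 \<le> d" by (intro exI) auto
    qed (use q in simp)
    then show ?thesis by (simp add: G_def)
  qed
  ultimately have "q * (1 + q / 2) \<le> q * (y / T_gel v0)"
    by (simp add: algebra_simps power2_eq_square)
  then have "1 + q / 2 \<le> y / T_gel v0" using q(1) by (rule mult_left_le_imp_le)
  then show ?thesis unfolding q_def by argo
qed

lemma curves_fill:
  assumes c: "\<And>y. T_gel v0 < y \<Longrightarrow> characteristic_curve v y (\<psi> y)"
    and t: "0 \<le> t" and z: "0 < z" "z < 1"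
  shows "\<exists>y>T_gel v0. \<psi> y t = z"
proof -
  obtain a where a: "T_gel v0 < a" "t \<le> a" "z \<le> \<psi> a t"
  proof (cases "T_gel v0 < t")
    case True
    then show ?thesis using that[of t] curve_eq_1[OF c[OF True]] t z by auto
  next
    case False
    \<comment> \<open>Chosen so that \<open>2 * (a / T_gel v0 - 1) = 1 - z\<close>. The bound at
      time 0 passes to \<open>t\<close> because curves are nondecreasing.\<close>
    define a where "a = T_gel v0 * (1 + (1 - z) / 2)"
    have a: "T_gel v0 < a" using T_gel_pos z by (simp add: a_def)
    have "1 - \<psi> a 0 \<le> 2 * (a / T_gel v0 - 1)" using a by (intro curve_0_near_1 c)
    also have "\<dots> = 1 - z" using T_gel_pos by (simp add: a_def field_simps)
    finally have "z \<le> \<psi> a t" using curve_mono[OF c[OF a], of 0 t] t by simp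
    then show ?thesis using that[of a] a False by auto
  qed
  obtain b where b: "a \<le> b" "\<psi> b t \<le> z"
  proof -
    have "eventually (\<lambda>y. \<psi> y t < z \<and> a \<le> y) at_top"
      using order_tendstoD(2)[OF curves_tendsto_0[of "T_gel v0" \<psi> t, OF c t] z(1)]
      by (auto intro: eventually_conj eventually_ge_at_top)
    then show ?thesis using that by (auto simp: eventually_at_top_linorder intro: less_imp_le)
  qed
  have range: "0 \<le> \<psi> y t" "\<psi> y t \<le> 1" if "a \<le> y" for y
    using curve_range[OF c t, of y] that a by auto
  have "\<exists>y\<ge>a. y \<le> b \<and> X t (\<psi> y t) = X t z"
  proof (rule IVT2')
    show "X t (\<psi> b t) \<le> X t z" "X t z \<le> X t (\<psi> a t)"
      using range b a z t by (auto intro!: X_mono)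
    show "continuous_on {a..b} (\<lambda>y. X t (\<psi> y t))"
      using c t a by (intro continuous_on_X_curves) auto
  qed (use b in auto)
  then obtain y where y: "a \<le> y" "X t (\<psi> y t) = X t z" by blast
  then have "\<psi> y t = z"
    using X_strict_mono[of t "\<psi> y t" z] X_strict_mono[of t z "\<psi> y t"] range[OF y(1)] t z
    by (cases "\<psi> y t" z rule: linorder_cases) auto
  then show ?thesis using y(1) a(1) by (intro exI[of _ y]) simp
qed

end

section \<open>Paths in the state space\<close>

context
  notes One_nat_def [simp del]
begin

lemma limitin_E_iff:
  "limitin E.mtopology x l G \<longleftrightarrow>
    1 \<le> l \<and> eventually (\<lambda>s. 1 \<le> x s) G \<and> ((\<lambda>s. f_E (x s)) \<longlongrightarrow> f_E l) G"
proof -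
  have "(\<forall>e>0. eventually (\<lambda>s. 1 \<le> x s \<and> \<bar>f_E (x s) - f_E l\<bar> < e) G) \<longleftrightarrow>
    eventually (\<lambda>s. 1 \<le> x s) G \<and> (\<forall>e>0. eventually (\<lambda>s. \<bar>f_E (x s) - f_E l\<bar> < e) G)"
    by (simp add: eventually_conj_iff) (metis zero_less_one)
  then show ?thesis
    unfolding E.limitin_metric d_E_def tendsto_iff dist_real_def by simp
qed

text \<open>Index 0 has to be excluded: division by zero makes \<open>f_E 0\<close> equal to
  \<open>f_E 1\<close>.\<close>

lemma f_E_inj: "f_E i = f_E j \<Longrightarrow> 1 \<le> i \<Longrightarrow> 1 \<le> j \<Longrightarrow> i = j"
  by (auto simp: f_E_def split: if_splits)

text \<open>The values \<open>1 / (l + 1)\<close> and \<open>1 / (l - 1)\<close> isolate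
  \<open>1 / l\<close>, and the image 0 of state 1 lies below both.\<close>

lemma limitin_E_isolated:
  assumes "limitin E.mtopology x l G" "2 \<le> l" shows "eventually (\<lambda>s. x s = l) G"
proof -
  have lim: "((\<lambda>s. f_E (x s)) \<longlongrightarrow> 1 / real l) G" and pos: "eventually (\<lambda>s. 1 \<le> x s) G"
    using assms by (auto simp: limitin_E_iff f_E_def)
  have "eventually (\<lambda>s. 1 / real (l + 1) < f_E (x s)) G" "eventually (\<lambda>s. f_E (x s) < 1 / real (l - 1)) G"
    using assms(2) by (auto intro!: order_tendstoD[OF lim] frac_less2)
  with pos show ?thesis
  proof eventually_elim
    case (elim s)
    have "x s \<noteq> 1"
    proof
      assume "x s = 1"
      then have "1 / real (l + 1) < 0" using elim by (simp add: f_E_def)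
      then show False by simp
    qed
    then have "1 / real (l + 1) < 1 / real (x s)" "1 / real (x s) < 1 / real (l - 1)"
      using elim by (auto simp: f_E_def)
    then have "real (x s) < real (l + 1)" "real (l - 1) < real (x s)"
      using elim assms(2) by (simp_all add: field_simps)
    then show ?case using assms(2) by linarith
  qed
qed

lemma cadlag_E_ge_1: "cadlag_E x \<Longrightarrow> 0 \<le> t \<Longrightarrow> 1 \<le> x t"
  by (auto simp: cadlag_E_def)

lemma cadlag_E_right_constant:
  assumes "cadlag_E x" "0 \<le> t" "2 \<le> x t"
  obtains d where "t < d" "\<And>s. t \<le> s \<Longrightarrow> s < d \<Longrightarrow> x s = x t"
proof -
  have "eventually (\<lambda>s. x s = x t) (at_right t)"
    using assms by (intro limitin_E_isolated) (auto simp: cadlag_E_def)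
  then obtain d where "t < d" "\<And>s. t < s \<Longrightarrow> s < d \<Longrightarrow> x s = x t"
    by (auto simp: eventually_at_right_field)
  then show ?thesis using that[of d] by (metis less_eq_real_def)
qed

lemma cadlag_E_eq_if_rationals:
  assumes "cadlag_E x" "0 \<le> t" "t < b" and q: "\<And>q. q \<in> \<rat> \<Longrightarrow> t < q \<Longrightarrow> q < b \<Longrightarrow> x q = k"
  shows "x t = k"
proof -
  have lim: "((\<lambda>s. f_E (x s)) \<longlongrightarrow> f_E (x t)) (at_right t)"
    using assms(1,2) by (auto simp: cadlag_E_def limitin_E_iff)
  obtain p where p: "p \<in> \<rat>" "t < p" "p < b" using Rats_dense_in_real[OF assms(3)] by auto
  then have "1 \<le> k" using cadlag_E_ge_1[OF assms(1), of p] q[of p] assms(2) by simp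
  have "f_E (x t) = f_E k"
  proof (rule ccontr)
    assume "f_E (x t) \<noteq> f_E k"
    then have "eventually (\<lambda>s. f_E (x s) \<noteq> f_E k) (at_right t)"
      by (rule tendsto_imp_eventually_ne[OF lim])
    then obtain d where d: "t < d" "\<And>s. t < s \<Longrightarrow> s < d \<Longrightarrow> f_E (x s) \<noteq> f_E k"
      by (auto simp: eventually_at_right_field)
    obtain r where "r \<in> \<rat>" "t < r" "r < min d b"
      using Rats_dense_in_real[of t "min d b"] d(1) assms(3) by auto
    then show False using d(2)[of r] q[of r] by simp
  qed
  then show ?thesis using f_E_inj cadlag_E_ge_1[OF assms(1,2)] \<open>1 \<le> k\<close> by blast
qed

lemma next_jumpE:
  assumes "next_jump x t s l"
  obtains u where "0 < u" "u \<le> s" "\<And>r. t \<le> r \<Longrightarrow> r < t + u \<Longrightarrow> x r = x t" "x (t + u) = x t + l"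
proof -
  obtain u where u: "u \<in> {0<..s}" "\<forall>r\<in>{t..<t + u}. x r = x t" "x (t + u) = x t + l"
    using assms unfolding next_jump_def by blast
  show ?thesis
  proof (rule that)
    show "x r = x t" if "t \<le> r" "r < t + u" for r using u(2) that by (metis atLeastLessThan_iff)
  qed (use u(1,3) in auto)
qed

text \<open>Countably many times make the next jump measurable. Either it occurs exactly at
  \<open>t + s\<close>, or earlier; then the new value, being at least 2, persists up to a rational
  \<open>q\<close>, and every rational time before \<open>q\<close> shows the old value or starts a
  stretch of the new one. Conversely the jump time is the infimum of the rational times at which the
  path has left \<open>x t\<close>.\<close>

lemma next_jump_iff_rationals:
  assumes x: "cadlag_E x" and t: "0 \<le> t" and l: "1 \<le> l"
  shows "next_jump x t s l \<longleftrightarrow>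
    (0 < s \<and> (\<forall>r\<in>\<rat> \<inter> {t<..<t + s}. x r = x t) \<and> x (t + s) = x t + l) \<or>
    (\<exists>q\<in>\<rat> \<inter> {t<..<t + s}. x q = x t + l \<and>
      (\<forall>r\<in>\<rat> \<inter> {t<..q}. x r = x t \<or> (\<forall>r'\<in>\<rat> \<inter> {r..q}. x r' = x t + l)))"
    (is "_ \<longleftrightarrow> ?A \<or> ?B")
proof
  assume "next_jump x t s l"
  then obtain u where u: "0 < u" "u \<le> s" "\<And>r. t \<le> r \<Longrightarrow> r < t + u \<Longrightarrow> x r = x t" "x (t + u) = x t + l"
    by (rule next_jumpE) blast
  show "?A \<or> ?B"
  proof (cases "u = s")
    case True
    have "\<forall>r\<in>\<rat> \<inter> {t<..<t + s}. x r = x t" by (intro ballI u(3)) (use True in auto)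
    then have ?A using u(1,4) True by simp
    then show ?thesis ..
  next
    case False
    have "1 \<le> x t" using x t by (rule cadlag_E_ge_1)
    then obtain d where d: "t + u < d" "\<And>r. t + u \<le> r \<Longrightarrow> r < d \<Longrightarrow> x r = x t + l"
      using cadlag_E_right_constant[OF x, of "t + u"] u(1,4) t l by auto
    obtain q where q: "q \<in> \<rat>" "t + u < q" "q < min d (t + s)"
      using Rats_dense_in_real[of "t + u" "min d (t + s)"] d(1) False u(2) by auto
    have "x r = x t \<or> (\<forall>r'\<in>\<rat> \<inter> {r..q}. x r' = x t + l)" if "r \<in> \<rat> \<inter> {t<..q}" for r
    proof (cases "r < t + u")
      case True
      then show ?thesis using u(3)[of r] that by auto
    next
      case False
      then show ?thesis using d(2) that q by auto
    qed
    then have ?B using q d(2)[of q] u(1) by (intro bexI[of _ q]) auto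
    then show ?thesis ..
  qed
next
  assume "?A \<or> ?B"
  then show "next_jump x t s l"
  proof
    assume A: ?A
    have const: "x r = x t" if "t \<le> r" "r < t + s" for r
      using A that t by (intro cadlag_E_eq_if_rationals[OF x _ that(2)]) auto
    show ?thesis unfolding next_jump_def
      by (intro bexI[of _ s] conjI ballI const) (use A in auto)
  next
    assume ?B
    then obtain q where q: "q \<in> \<rat>" "t < q" "q < t + s" "x q = x t + l"
      and dich: "\<And>r. r \<in> \<rat> \<Longrightarrow> t < r \<Longrightarrow> r \<le> q \<Longrightarrow> x r = x t \<or> (\<forall>r'\<in>\<rat> \<inter> {r..q}. x r' = x t + l)"
      by auto
    define S where "S = {r\<in>\<rat> \<inter> {t<..q}. x r \<noteq> x t}"
    define \<tau> where "\<tau> = Inf S"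
    have "q \<in> S" using q l by (auto simp: S_def)
    have "bdd_below S" by (auto simp: S_def intro!: bdd_belowI[of _ t])
    have \<tau>: "t \<le> \<tau>" "\<tau> \<le> q"
      using \<open>q \<in> S\<close> \<open>bdd_below S\<close> unfolding \<tau>_def
      by (auto intro!: cInf_greatest cInf_lower simp: S_def)
    have below: "x r = x t" if "r \<in> \<rat>" "t < r" "r < \<tau>" for r
    proof (rule ccontr)
      assume "x r \<noteq> x t"
      then have "r \<in> S" using that \<tau> by (auto simp: S_def)
      then show False using cInf_lower[OF _ \<open>bdd_below S\<close>, of r] that by (simp add: \<tau>_def)
    qed
    have above: "x r = x t + l" if r: "r \<in> \<rat>" "\<tau> < r" "r \<le> q" for r
    proof -
      obtain p where "p \<in> S" "p < r"
        using r \<open>q \<in> S\<close> cInf_less_iff[of S r] \<open>bdd_below S\<close> unfolding \<tau>_def by auto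
      then show ?thesis using dich[of p] r by (auto simp: S_def)
    qed
    have at: "x \<tau> = x t + l"
    proof (cases "\<tau> = q")
      case False
      show ?thesis
      proof (rule cadlag_E_eq_if_rationals[OF x])
        show "0 \<le> \<tau>" "\<tau> < q" using \<tau> t False by auto
        show "x r = x t + l" if "r \<in> \<rat>" "\<tau> < r" "r < q" for r using above that by auto
      qed
    qed (use q in simp)
    have const: "x r = x t" if "t \<le> r" "r < \<tau>" for r
      using t that below by (intro cadlag_E_eq_if_rationals[OF x _ that(2)]) auto
    have "t \<noteq> \<tau>" using at l by auto
    then show ?thesis unfolding next_jump_def
      by (intro bexI[of _ "\<tau> - t"] conjI ballI const) (use \<tau> q(3) at in auto)
  qed
qed

text \<open>There is only one first time at which the path leaves \<open>x t\<close>. Hence the jump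
  events for different increments are disjoint.\<close>

lemma next_jump_increment_unique:
  assumes "next_jump x t s l" "next_jump x t s' l'" "1 \<le> l" "1 \<le> l'" shows "l = l'"
proof -
  obtain u where u: "0 < u" "\<And>r. t \<le> r \<Longrightarrow> r < t + u \<Longrightarrow> x r = x t" "x (t + u) = x t + l"
    using assms(1) by (rule next_jumpE) blast
  obtain u' where u': "0 < u'" "\<And>r. t \<le> r \<Longrightarrow> r < t + u' \<Longrightarrow> x r = x t" "x (t + u') = x t + l'"
    using assms(2) by (rule next_jumpE) blast
  have "u = u'"
    using u(2)[of "t + u'"] u'(2)[of "t + u"] u(1,3) u'(1,3) assms(3,4) by (cases u u' rule: linorder_cases) auto
  then show ?thesis using u(3) u'(3) by simp
qed

text \<open>The jump time may be irrational, but the state entered is isolated and therefore still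
  held at a rational time shortly afterwards.\<close>

lemma next_jump_le_if_mono_rationals:
  assumes x: "cadlag_E x" and p: "0 \<le> p" "p < r" "r \<in> \<rat>" and l: "1 \<le> l"
    and jump: "next_jump x p (r - p) l"
    and mono: "\<And>q. q \<in> \<rat> \<Longrightarrow> p \<le> q \<Longrightarrow> q \<le> r \<Longrightarrow> x q \<le> x r"
  shows "x p + l \<le> x r"
proof -
  obtain u where u: "0 < u" "u \<le> r - p" "x (p + u) = x p + l"
    using jump by (rule next_jumpE) blast
  have "1 \<le> x p" using x p(1) by (rule cadlag_E_ge_1)
  then obtain d where d: "p + u < d" "\<And>s. p + u \<le> s \<Longrightarrow> s < d \<Longrightarrow> x s = x p + l"
    using cadlag_E_right_constant[OF x, of "p + u"] u p l by auto
  show ?thesis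
  proof (cases "p + u = r")
    case False
    then obtain q where q: "q \<in> \<rat>" "p + u < q" "q < min d r"
      using Rats_dense_in_real[of "p + u" "min d r"] d(1) u(2) by auto
    then have "x q = x p + l" using d(2)[of q] by simp
    then show ?thesis using mono[of q] q u(1) by simp
  qed (use u in simp)
qed

text \<open>The path increases up to the supremum of the times before which it is monotone. There it
  either jumps upwards or arrives at \<open>1\<close>; in the latter case it explodes.\<close>

lemma mono_if_no_explosion:
  assumes x: "cadlag_E x" and jumps: "jumps_only_out_of_states x"
    and n: "0 \<le> n" "n \<in> \<rat>"
    and next_jump: "\<And>q. q \<in> \<rat> \<Longrightarrow> n \<le> q \<Longrightarrow> \<exists>s l. 1 \<le> l \<and> next_jump x q s l"
    and no_explosion: "\<And>t. n < t \<Longrightarrow> \<not> explodes_at x t"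
  shows "mono_on {n..} x"
proof (rule ccontr)
  define S where "S = {t. n \<le> t \<and> mono_on {n..t} x}"
  have glue: "d \<in> S" if q: "q \<in> S" and d: "\<And>s t. q < t \<Longrightarrow> s \<le> t \<Longrightarrow> t \<le> d \<Longrightarrow> n \<le> s \<Longrightarrow> x s \<le> x t" "q \<le> d" for q d
    unfolding S_def
  proof (intro CollectI conjI mono_onI)
    show "n \<le> d" using q d by (auto simp: S_def)
    fix s t assume "s \<in> {n..d}" "t \<in> {n..d}" "s \<le> t"
    then show "x s \<le> x t" using q d(1)[of t s]
      by (cases "t \<le> q") (auto simp: S_def intro: mono_onD[of "{n..q}"])
  qed
  have "n \<in> S" by (auto simp: S_def intro: mono_onI)
  assume "\<not> mono_on {n..} x"
  then obtain a b where ab: "n \<le> a" "a \<le> b" "\<not> x a \<le> x b" by (auto simp: mono_on_def)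
  have bound: "t < b" if "t \<in> S" for t
  proof (rule ccontr)
    assume "\<not> t < b"
    then show False using that ab by (auto simp: S_def dest: mono_onD[of _ x a b])
  qed
  then have bdd: "bdd_above S" by (auto intro!: bdd_aboveI less_imp_le)
  define \<sigma> where "\<sigma> = Sup S"
  have le: "t \<le> \<sigma>" if "t \<in> S" for t unfolding \<sigma>_def using that bdd by (rule cSup_upper)
  have below: "t \<in> S" if "n \<le> t" "t < \<sigma>" for t
  proof -
    obtain s where "s \<in> S" "t < s"
      using \<open>t < \<sigma>\<close> less_cSup_iff[OF _ bdd, of t] \<open>n \<in> S\<close> unfolding \<sigma>_def by auto
    then show ?thesis using that by (auto simp: S_def elim: mono_on_subset)
  qed
  have mono: "x s \<le> x t" if "n \<le> s" "s \<le> t" "t < \<sigma>" for s t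
    using below[of t] that by (auto simp: S_def intro: mono_onD[of "{n..t}"])
  have "n < \<sigma>"
  proof -
    obtain s l where "next_jump x n s l" using next_jump[of n] n by auto
    then obtain u where u: "0 < u" "\<And>r. n \<le> r \<Longrightarrow> r < n + u \<Longrightarrow> x r = x n" by (rule next_jumpE) blast
    have "n + u / 2 \<in> S"
    proof (rule glue[OF \<open>n \<in> S\<close>])
      fix s t assume "n < t" "s \<le> t" "t \<le> n + u / 2" "n \<le> s"
      then show "x s \<le> x t" using u(2)[of s] u(2)[of t] u(1) by simp
    qed (use u(1) in simp)
    then show ?thesis using le[of "n + u / 2"] u(1) by simp
  qed
  \<comment> \<open>Otherwise \<open>x\<close> tends to \<open>x \<sigma>\<close> from the left, and
    \<open>x \<sigma> = 1\<close> as all other states are isolated. The monotone path is not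
    constantly 1 before \<open>\<sigma>\<close>, and once above 1 it stays there, so
    \<open>\<sigma>\<close> would be an explosion.\<close>
  have "\<exists>k. eventually (\<lambda>s. x s = k) (at_left \<sigma>)"
  proof (rule ccontr)
    assume not_ev: "\<nexists>k. eventually (\<lambda>s. x s = k) (at_left \<sigma>)"
    then have lim: "limitin E.mtopology x (x \<sigma>) (at_left \<sigma>)"
      using jumps[unfolded jumps_only_out_of_states_def, rule_format, of \<sigma>] \<open>n < \<sigma>\<close> n by fastforce
    then have "x \<sigma> = 1"
      using not_ev limitin_E_isolated[OF lim] lim[unfolded limitin_E_iff] by fastforce
    show False
    proof (cases "\<forall>s. n \<le> s \<longrightarrow> s < \<sigma> \<longrightarrow> x s = 1")
      case True
      have "eventually (\<lambda>s. x s = 1) (at_left \<sigma>)"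
        using eventually_at_left_real[OF \<open>n < \<sigma>\<close>] by eventually_elim (use True in auto)
      then show False using not_ev by blast
    next
      case False
      then obtain c where c: "n \<le> c" "c < \<sigma>" "x c \<noteq> 1" by auto
      have "x s \<noteq> 1" if "c < s" "s < \<sigma>" for s
        using mono[of c s] that c cadlag_E_ge_1[OF x, of c] n by auto
      then have "explodes_at x \<sigma>"
        unfolding explodes_at_def using c \<open>x \<sigma> = 1\<close> \<open>n < \<sigma>\<close> n
        by (auto intro!: exI[of _ "\<sigma> - c"])
      then show False using no_explosion[OF \<open>n < \<sigma>\<close>] by simp
    qed
  qed
  then obtain k c where c: "c < \<sigma>" "\<And>s. c < s \<Longrightarrow> s < \<sigma> \<Longrightarrow> x s = k"
    by (auto simp: eventually_at_left_field)
  obtain q where q: "q \<in> \<rat>" "max c n < q" "q < \<sigma>"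
    using Rats_dense_in_real[of "max c n" \<sigma>] c(1) \<open>n < \<sigma>\<close> by auto
  have "x q = k" using c q by auto
  obtain s l where "1 \<le> l" "next_jump x q s l" using next_jump[of q] q by auto
  then obtain u where u: "0 < u" "\<And>r. q \<le> r \<Longrightarrow> r < q + u \<Longrightarrow> x r = k" "x (q + u) = k + l"
    using \<open>x q = k\<close> by (metis next_jumpE)
  have "q \<in> S" using q by (intro below) auto
  have le_k: "x s \<le> k" if "n \<le> s" "s \<le> q" for s
    using mono[of s q] that q \<open>x q = k\<close> by simp
  \<comment> \<open>A jump before \<open>\<sigma>\<close> contradicts constancy to the left of
    \<open>\<sigma>\<close>; a jump at or after \<open>\<sigma>\<close> extends monotonicity beyond
    \<open>\<sigma>\<close>.\<close>
  consider "q + u < \<sigma>" | "\<sigma> < q + u" | "q + u = \<sigma>" by linarith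
  then show False
  proof cases
    case 1
    then show False using c(2)[of "q + u"] u q \<open>1 \<le> l\<close> by auto
  next
    case 2
    define d where "d = (\<sigma> + (q + u)) / 2"
    have d: "\<sigma> < d" "d < q + u" using 2 by (auto simp: d_def)
    have "d \<in> S"
    proof (rule glue[OF \<open>q \<in> S\<close>])
      fix s t assume "q < t" "s \<le> t" "t \<le> d" "n \<le> s"
      then show "x s \<le> x t" using le_k[of s] u(2)[of s] u(2)[of t] d by (cases "s \<le> q") auto
    qed (use d q in auto)
    then show False using le[of d] d by simp
  next
    case 3
    have "1 \<le> k" using cadlag_E_ge_1[OF x, of q] \<open>x q = k\<close> q n by auto
    then obtain e where e: "\<sigma> < e" "\<And>s. \<sigma> \<le> s \<Longrightarrow> s < e \<Longrightarrow> x s = k + l"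
      using cadlag_E_right_constant[OF x, of \<sigma>] u(3) 3 n \<open>n < \<sigma>\<close> \<open>1 \<le> l\<close> by auto
    define d where "d = (\<sigma> + e) / 2"
    have d: "\<sigma> < d" "d < e" using e(1) by (auto simp: d_def)
    have "d \<in> S"
    proof (rule glue[OF \<open>q \<in> S\<close>])
      fix s t assume st: "q < t" "s \<le> t" "t \<le> d" "n \<le> s"
      have "x r = (if r < \<sigma> then k else k + l)" if "q < r" "r \<le> d" for r
        using that u(2)[of r] e(2)[of r] d 3 by auto
      then show "x s \<le> x t" using le_k[of s] st by (cases "s \<le> q") (auto split: if_splits)
    qed (use d q in auto)
    then show False using le[of d] d by simp
  qed
qed

end

section \<open>The law of the next jump and the one-step drift along a curve\<close>

context forest_fire
begin

text \<open>The right-hand side of \<open>jump_dynamics\<close> at the constant time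
  \<open>t\<close>, as a function of the state \<open>k\<close>.\<close>

definition jump_law :: "real \<Rightarrow> real \<Rightarrow> nat \<Rightarrow> nat \<Rightarrow> real" where
  "jump_law t s l k = integral {0..s} (\<lambda>r. real k * exp (- real k * r) * v l (t + r))"

lemma jump_law_sum_ge:
  assumes t: "0 \<le> t" and g: "g integrable_on {0..s}"
    and le: "\<And>r. 0 \<le> r \<Longrightarrow> r \<le> s \<Longrightarrow> g r \<le> real k * exp (- real k * r) * (\<Sum>l=1..L. a l * u l (t + r))"
  shows "integral {0..s} g \<le> (\<Sum>l=1..L. a l * jump_law t s l k)"
proof -
  have cont: "continuous_on {0..s} (\<lambda>r. u l (t + r))" for l
    by (rule continuous_on_compose2[OF continuous_on_u]) (use t in \<open>auto intro!: continuous_intros\<close>)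
  have int: "(\<lambda>r. real k * exp (- real k * r) * u l (t + r)) integrable_on {0..s}" for l
    by (intro integrable_continuous_interval continuous_intros cont)
  have law: "jump_law t s l k = integral {0..s} (\<lambda>r. real k * exp (- real k * r) * u l (t + r))" if "l \<in> {1..L}" for l
    using that by (simp add: jump_law_def u_def)
  have "integral {0..s} g \<le> integral {0..s} (\<lambda>r. \<Sum>l=1..L. a l * (real k * exp (- real k * r) * u l (t + r)))"
  proof (rule integral_le[OF g])
    show "(\<lambda>r. \<Sum>l=1..L. a l * (real k * exp (- real k * r) * u l (t + r))) integrable_on {0..s}"
      by (intro integrable_continuous_interval continuous_intros cont)
    show "g r \<le> (\<Sum>l=1..L. a l * (real k * exp (- real k * r) * u l (t + r)))" if "r \<in> {0..s}" for r
      using le[of r] that by (simp add: sum_distrib_left mult_ac)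
  qed
  also have "\<dots> = (\<Sum>l=1..L. integral {0..s} (\<lambda>r. a l * (real k * exp (- real k * r) * u l (t + r))))"
    by (intro integral_sum integrable_on_mult_right int) simp
  also have "\<dots> = (\<Sum>l=1..L. a l * jump_law t s l k)"
    by (intro sum.cong refl) (simp add: law)
  finally show ?thesis .
qed

lemma sum_u_eq_from_1: "(\<Sum>l<Suc L. f l * u l t) = (\<Sum>l=1..L. f l * u l t)"
  by (simp add: lessThan_Suc_atMost atMost_atLeast0 sum.atLeast_Suc_atMost)

text \<open>A jump within time \<open>s\<close> has probability \<open>1 - exp (- k * s)\<close>,
  smallest for \<open>k = 1\<close>. Uniform tails on \<open>[0, t + s]\<close> yield one level
  \<open>L\<close> for all states, as required when the state is random.\<close>

lemma jump_law_total_ge: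
  assumes t: "0 \<le> t" and s: "0 \<le> s" and e: "0 < e" "e \<le> 1"
  shows "\<exists>L. \<forall>k\<ge>1. (1 - e) * (1 - exp (- s)) \<le> (\<Sum>l=1..L. jump_law t s l k)"
proof -
  obtain L where L: "\<And>n r. n \<ge> L \<Longrightarrow> r \<in> {0..t + s} \<Longrightarrow> 1 - e < (\<Sum>k<n. u k r)"
    using uniform_tails[OF e(1), of "t + s"] by blast
  have "(1 - e) * (1 - exp (- s)) \<le> (\<Sum>l=1..L. 1 * jump_law t s l k)" if k: "1 \<le> k" for k
  proof -
    have hi: "((\<lambda>r. (1 - e) * (real k * exp (- real k * r))) has_integral
        (1 - e) * (- exp (- real k * s) - - exp (- real k * 0))) {0..s}"
      by (intro has_integral_mult_right fundamental_theorem_of_calculus s)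
        (auto intro!: derivative_eq_intros simp flip: has_real_derivative_iff_has_vector_derivative)
    have "(1 - e) * (1 - exp (- s)) \<le> (1 - e) * (- exp (- real k * s) - - exp (- real k * 0))"
      using e s k mult_right_mono[of 1 "real k" s] by (intro mult_left_mono) auto
    also have "\<dots> \<le> (\<Sum>l=1..L. 1 * jump_law t s l k)"
      unfolding integral_unique[OF hi, symmetric]
    proof (rule jump_law_sum_ge[OF t has_integral_integrable[OF hi]])
      fix r assume r: "0 \<le> r" "r \<le> s"
      have "1 - e \<le> (\<Sum>l<Suc L. 1 * u l (t + r))"
        using L[of "Suc L" "t + r"] r t by (simp del: sum.lessThan_Suc)
      then have "1 - e \<le> (\<Sum>l=1..L. 1 * u l (t + r))" by (simp only: sum_u_eq_from_1)
      then show "(1 - e) * (real k * exp (- real k * r))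
          \<le> real k * exp (- real k * r) * (\<Sum>l=1..L. 1 * u l (t + r))"
        using mult_right_mono[of "1 - e" "\<Sum>l=1..L. 1 * u l (t + r)" "real k * exp (- real k * r)"]
        by (simp add: mult.commute)
    qed
    finally show ?thesis .
  qed
  then show ?thesis by auto
qed

text \<open>The logarithm of \<open>z\<close> has derivative \<open>1 - X\<close>, and
  \<open>X\<close> is nondecreasing along the curve, so the rate at the left end bounds the
  growth.\<close>

lemma curve_log_growth:
  assumes c: "characteristic_curve v y z" and t: "0 \<le> t" "0 \<le> h" "t + h \<le> y"
  shows "z (t + h) \<le> z t * exp ((1 - X t (z t)) * h)"
proof -
  define D where "D s = (1 - X t (z t)) * s - ln (z s)" for s
  have "D t \<le> D (t + h)"
  proof (rule DERIV_nonneg_imp_increasing_open[where f = D])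
    have "z x \<noteq> 0" if "0 \<le> x" for x using curve_range(1)[OF c that] by simp
    then show "continuous_on {t..t + h} D"
      unfolding D_def using t by (intro continuous_intros continuous_on_curve[OF c]) auto
    fix x assume x: "t < x" "x < t + h"
    have "(D has_real_derivative (1 - X t (z t)) - (1 - X x (z x))) (at x)"
      unfolding D_def using curve_range(1)[OF c, of x] x t
      by (auto intro!: derivative_eq_intros curve_deriv[OF c] simp: field_simps)
    moreover have "X t (z t) \<le> X x (z x)" using x t by (intro curve_X_mono[OF c]) auto
    ultimately show "\<exists>d. (D has_real_derivative d) (at x) \<and> 0 \<le> d" by (intro exI) auto
  qed (use t in simp)
  then have "ln (z (t + h)) \<le> ln (z t) + (1 - X t (z t)) * h"
    by (simp add: D_def algebra_simps)
  then have "exp (ln (z (t + h))) \<le> exp (ln (z t) + (1 - X t (z t)) * h)" by simp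
  then show ?thesis
    using curve_range(1)[OF c, of t] curve_range(1)[OF c, of "t + h"] t by (simp add: exp_add)
qed

text \<open>Along a characteristic curve the growth of \<open>z\<^sup>k\<close> compensates in first order for the mean
  decrease of \<open>z\<^sup>C\<close> when \<open>C\<close> jumps out of \<open>k\<close>.\<close>

lemma one_step_supermartingale:
  assumes c: "characteristic_curve v y z" and e: "0 < e" and N: "1 \<le> N"
  shows "\<exists>d>0. \<exists>L. \<forall>t h k. 0 \<le> t \<longrightarrow> 0 < h \<longrightarrow> h \<le> d \<longrightarrow> t + h \<le> y \<longrightarrow> 1 \<le> k \<longrightarrow> k \<le> N \<longrightarrow>
    z (t + h) ^ k * (1 - (\<Sum>l=1..L. (1 - z (t + h) ^ l) * jump_law t h l k)) \<le> exp (e * h) * z t ^ k"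
proof -
  \<comment> \<open>The exponent is off by at most \<open>4 * e'\<close> per unit of
    \<open>k * h\<close>, and \<open>k <= N\<close>. Three errors arise in the rate \<open>m\<close>
    (moving \<open>z\<close>, moving time, cutting off at \<open>L\<close>), the fourth from the
    exponential density.\<close>
  define e' where "e' = e / (4 * real N)"
  have e': "0 < e'" using e N by (simp add: e'_def)
  obtain L where L: "\<And>n r. n \<ge> L \<Longrightarrow> r \<in> {0..y} \<Longrightarrow> 1 - e' < (\<Sum>k<n. u k r)"
    using uniform_tails[OF e', of y] by blast
  obtain d1 where d1: "0 < d1" "\<And>r a b. r \<in> {0..y} \<Longrightarrow> a \<in> {0..1} \<Longrightarrow> b \<in> {0..1} \<Longrightarrow> \<bar>a - b\<bar> \<le> d1 \<Longrightarrow> \<bar>X r a - X r b\<bar> \<le> e'"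
    using X_uniformly_continuous[OF e', of y] by blast
  have "uniformly_continuous_on {0..y} (\<lambda>r. X r (z r))"
    by (intro compact_uniformly_continuous continuous_on_X_curve[OF c]) auto
  then obtain d2 where d2: "0 < d2" "\<And>r r'. r \<in> {0..y} \<Longrightarrow> r' \<in> {0..y} \<Longrightarrow> dist r' r < d2 \<Longrightarrow> dist (X r' (z r')) (X r (z r)) < e'"
    using e' unfolding uniformly_continuous_on_def by metis
  \<comment> \<open>The last bound gives \<open>k * h <= e'\<close> for all \<open>k <= N\<close>,
    so \<open>1 - exp (- k * h)\<close> is small as well.\<close>
  define d where "d = min (min d1 (d2 / 2)) (e' / real N)"
  have "0 < d" using d1(1) d2(1) e' N by (simp add: d_def)
  moreover have "z (t + h) ^ k * (1 - (\<Sum>l=1..L. (1 - z (t + h) ^ l) * jump_law t h l k)) \<le> exp (e * h) * z t ^ k"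
    if t: "0 \<le> t" and h: "0 < h" "h \<le> d" "t + h \<le> y" and k: "1 \<le> k" "k \<le> N" for t h k
  proof -
    define w where "w = z (t + h)"
    define m where "m = 1 - X t (z t)"
    \<comment> \<open>The minimum of the density \<open>k * exp (- k * r)\<close> over
      \<open>[0, h]\<close>.\<close>
    define q where "q = real k * exp (- real k * h)"
    have z: "0 < z s" "z s \<le> 1" if "0 \<le> s" for s using curve_range[OF c that] by auto
    have w: "0 < w" "w \<le> 1" using z t h by (auto simp: w_def)
    have m: "0 \<le> m" "m \<le> 1"
      using z[OF t] t by (auto simp: m_def intro: X_nonneg X_curve_le_1[OF c])
    have "integral {0..h} (\<lambda>_. q * (m - 3 * e')) \<le> (\<Sum>l=1..L. (1 - w ^ l) * jump_law t h l k)"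
    proof (rule jump_law_sum_ge[OF t])
      fix r assume r: "0 \<le> r" "r \<le> h"
      then have tr: "t + r \<in> {0..y}" using t h by auto
      have "\<bar>w - z (t + r)\<bar> \<le> d1"
        using curve_increment_le[OF c, of "t + r" "t + h"] curve_mono[OF c, of "t + r" "t + h"] r t h
        by (simp add: w_def d_def)
      then have "\<bar>X (t + r) w - X (t + r) (z (t + r))\<bar> \<le> e'"
        using tr w z[of "t + r"] by (intro d1(2)) auto
      moreover have "dist (X (t + r) (z (t + r))) (X t (z t)) < e'"
        using tr t r h by (intro d2(2)) (auto simp: dist_real_def d_def)
      moreover have "1 - e' < (\<Sum>l<Suc L. u l (t + r))" using tr by (intro L) auto
      moreover have "(\<Sum>l<Suc L. u l (t + r) * w ^ l) \<le> X (t + r) w"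
      proof -
        have "(\<lambda>l. u l (t + r) * w ^ l) sums X (t + r) w" using tr w by (intro X_sums) auto
        then show ?thesis
          using w tr by (intro sum_le_suminf[of "\<lambda>l. u l (t + r) * w ^ l" "{..<Suc L}", THEN order_trans])
            (auto simp: sums_iff u_nonneg)
      qed
      ultimately have "m - 3 * e' \<le> (\<Sum>l<Suc L. u l (t + r)) - (\<Sum>l<Suc L. u l (t + r) * w ^ l)"
        unfolding m_def dist_real_def by linarith
      also have "\<dots> = (\<Sum>l<Suc L. (1 - w ^ l) * u l (t + r))"
        by (simp add: algebra_simps sum_subtractf del: sum.lessThan_Suc)
      also have "\<dots> = (\<Sum>l=1..L. (1 - w ^ l) * u l (t + r))" by (rule sum_u_eq_from_1)
      finally have "m - 3 * e' \<le> (\<Sum>l=1..L. (1 - w ^ l) * u l (t + r))" .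
      then have "q * (m - 3 * e') \<le> q * (\<Sum>l=1..L. (1 - w ^ l) * u l (t + r))"
        by (intro mult_left_mono) (auto simp: q_def)
      also have "\<dots> \<le> real k * exp (- real k * r) * (\<Sum>l=1..L. (1 - w ^ l) * u l (t + r))"
        using r w tr by (intro mult_right_mono sum_nonneg mult_nonneg_nonneg u_nonneg)
          (auto simp: q_def power_le_one mult_left_mono)
      finally show "q * (m - 3 * e') \<le> real k * exp (- real k * r) * (\<Sum>l=1..L. (1 - w ^ l) * u l (t + r))" .
    qed (intro integrable_continuous_interval continuous_on_const)
    then have "1 - (\<Sum>l=1..L. (1 - w ^ l) * jump_law t h l k) \<le> 1 + - (h * (q * (m - 3 * e')))"
      using h by (simp add: mult.left_commute[of q h])
    also have "\<dots> \<le> exp (- (h * (q * (m - 3 * e'))))" by (rule exp_ge_add_one_self)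
    finally have sum: "1 - (\<Sum>l=1..L. (1 - w ^ l) * jump_law t h l k) \<le> exp (- (h * (q * (m - 3 * e'))))" .
    have "w ^ k \<le> (z t * exp (m * h)) ^ k"
      using curve_log_growth[OF c t, of h] h w by (intro power_mono) (auto simp: w_def m_def)
    then have "w ^ k \<le> z t ^ k * exp (real k * (m * h))" by (simp add: power_mult_distrib exp_of_nat_mult)
    then have "w ^ k * (1 - (\<Sum>l=1..L. (1 - w ^ l) * jump_law t h l k))
        \<le> w ^ k * exp (- (h * (q * (m - 3 * e'))))"
      using sum w by (intro mult_left_mono) auto
    also have "\<dots> \<le> z t ^ k * exp (real k * (m * h)) * exp (- (h * (q * (m - 3 * e'))))"
      using \<open>w ^ k \<le> z t ^ k * exp (real k * (m * h))\<close> by (intro mult_right_mono) auto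
    also have "\<dots> = z t ^ k * exp (real k * (m * h) - h * (q * (m - 3 * e')))"
      by (simp only: mult.assoc exp_add[symmetric] diff_conv_add_uminus)
    also have "\<dots> \<le> z t ^ k * exp (e * h)"
    proof -
      define x where "x = exp (- real k * h)"
      have x: "0 \<le> x" "x \<le> 1" "1 - real k * h \<le> x"
        using h exp_ge_add_one_self[of "- real k * h"] by (auto simp: x_def)
      have "real k * h \<le> real N * (e' / real N)"
        using k h by (intro mult_mono) (auto simp: d_def)
      then have "real k * h \<le> e'" using N by simp
      have "m * (1 - x) \<le> 1 * e'" using m x \<open>real k * h \<le> e'\<close> by (intro mult_mono) auto
      moreover have "e' * x \<le> e' * 1" using e' x by (intro mult_left_mono) auto
      ultimately have "m * (1 - x) + 3 * (e' * x) \<le> 4 * e'" by simp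
      then have "real k * h * (m * (1 - x) + 3 * (e' * x)) \<le> real k * h * (4 * e')"
        using h by (intro mult_left_mono) auto
      also have "\<dots> \<le> real N * h * (4 * e')" using k h e' by (intro mult_right_mono) auto
      also have "\<dots> = e * h" using N by (simp add: e'_def)
      finally have "real k * (m * h) - h * (q * (m - 3 * e')) \<le> e * h"
        by (simp add: q_def x_def algebra_simps)
      then show ?thesis using z[OF t] by (intro mult_left_mono) auto
    qed
    finally show ?thesis by (simp add: w_def mult.commute)
  qed
  ultimately show ?thesis by blast
qed

end

section \<open>The tagged-cluster process\<close>

lemma pred_countable_Ball:
  "countable I \<Longrightarrow> (\<And>i. i \<in> I \<Longrightarrow> Measurable.pred M (P i)) \<Longrightarrow> Measurable.pred M (\<lambda>x. \<forall>i\<in>I. P i x)"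
  by (simp add: pred_def sets.sets_Collect_countable_Ball)

lemma pred_countable_Bex:
  "countable I \<Longrightarrow> (\<And>i. i \<in> I \<Longrightarrow> Measurable.pred M (P i)) \<Longrightarrow> Measurable.pred M (\<lambda>x. \<exists>i\<in>I. P i x)"
  by (simp add: pred_def sets.sets_Collect_countable_Bex)

lemma pred_relation_countable:
  fixes X :: "'a \<Rightarrow> 'b::countable"
  assumes X: "X \<in> M \<rightarrow>\<^sub>M count_space UNIV" and Y: "Y \<in> M \<rightarrow>\<^sub>M count_space UNIV"
  shows "Measurable.pred M (\<lambda>x. R (X x) (Y x))"
proof (rule measurable_compose_countable[OF _ X])
  show "Measurable.pred M (\<lambda>x. R i (Y x))" for i
    by (rule measurable_compose[OF Y]) simp
qed

lemma integral_diff_sum: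
  fixes f :: "'a \<Rightarrow> real"
  assumes "integrable M f" and g: "\<And>l. l \<in> I \<Longrightarrow> integrable M (g l)"
  shows "(\<integral>x. f x - (\<Sum>l\<in>I. a l * g l x) \<partial>M) = (\<integral>x. f x \<partial>M) - (\<Sum>l\<in>I. a l * (\<integral>x. g l x \<partial>M))"
proof -
  have ag: "integrable M (\<lambda>x. a l * g l x)" if "l \<in> I" for l using g[OF that] by simp
  have "(\<integral>x. (\<Sum>l\<in>I. a l * g l x) \<partial>M) = (\<Sum>l\<in>I. a l * (\<integral>x. g l x \<partial>M))"
    by (subst Bochner_Integration.integral_sum) (auto intro: ag g)
  then show ?thesis
    by (subst Bochner_Integration.integral_diff) (auto intro!: assms(1) Bochner_Integration.integrable_sum ag)
qed

locale tagged_cluster = forest_fire v0 v for v0 v +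
  fixes M :: "'a measure" and C :: "real \<Rightarrow> 'a \<Rightarrow> nat"
  assumes process: "tagged_cluster_process v M C"
begin

sublocale prob_space M
  using process by (auto simp: tagged_cluster_process_def)

sublocale filtration "space M" "natural_filtration M C"
  by (rule filtration_natural_filtration)

lemma measurable_C [measurable]: "0 \<le> t \<Longrightarrow> C t \<in> M \<rightarrow>\<^sub>M count_space UNIV"
  using process by (auto simp: tagged_cluster_process_def)

lemma cadlag_C: "\<omega> \<in> space M \<Longrightarrow> cadlag_E (\<lambda>t. C t \<omega>)"
  using process by (auto simp: tagged_cluster_process_def)

lemma C_ge_1: "\<omega> \<in> space M \<Longrightarrow> 0 \<le> t \<Longrightarrow> 1 \<le> C t \<omega>"
  using cadlag_E_ge_1[OF cadlag_C] .

lemma measurable_C_natural_filtration: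
  assumes "0 \<le> s" "s \<le> t" shows "C s \<in> natural_filtration M C t \<rightarrow>\<^sub>M count_space UNIV"
proof (rule measurableI)
  show "C s -` A \<inter> space (natural_filtration M C t) \<in> sets (natural_filtration M C t)" for A
    unfolding space_F using assms by (auto simp: natural_filtration_def intro!: in_measure_of)
qed simp

lemma sets_natural_filtration_subset: "sets (natural_filtration M C t) \<subseteq> sets M"
proof -
  let ?G = "{C s -` A \<inter> space M |s A. 0 \<le> s \<and> s \<le> t}"
  have "?G \<subseteq> sets M" using measurable_sets[OF measurable_C] by auto
  moreover have "?G \<subseteq> Pow (space M)" by auto
  ultimately show ?thesis by (simp add: natural_filtration_def sets.sigma_sets_subset)
qed

section \<open>Next-jump events and their expectations\<close>

definition next_jump_event :: "real \<Rightarrow> real \<Rightarrow> nat \<Rightarrow> 'a set" where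
  "next_jump_event t s l = {\<omega>\<in>space M. next_jump (\<lambda>t. C t \<omega>) t s l}"

lemma sets_next_jump_event [measurable]:
  assumes "0 \<le> t" "0 \<le> s" "1 \<le> l" shows "next_jump_event t s l \<in> sets M"
proof -
  have eq: "Measurable.pred M (\<lambda>\<omega>. C r \<omega> = C t \<omega> + i)" if "0 \<le> r" for r i
    using pred_relation_countable[OF measurable_C[OF that] measurable_C[OF \<open>0 \<le> t\<close>]] .
  \<comment> \<open>The \<open>+ 0\<close> brings every equality into the form covered by
    \<open>eq\<close>.\<close>
  have "Measurable.pred M (\<lambda>\<omega>.
    (0 < s \<and> (\<forall>r\<in>\<rat> \<inter> {t<..<t + s}. C r \<omega> = C t \<omega> + 0) \<and> C (t + s) \<omega> = C t \<omega> + l) \<or>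
    (\<exists>q\<in>\<rat> \<inter> {t<..<t + s}. C q \<omega> = C t \<omega> + l \<and>
      (\<forall>r\<in>\<rat> \<inter> {t<..q}. C r \<omega> = C t \<omega> + 0 \<or> (\<forall>r'\<in>\<rat> \<inter> {r..q}. C r' \<omega> = C t \<omega> + l))))"
    using assms
    by (intro pred_intros_logic pred_countable_Ball pred_countable_Bex eq measurable_const countable_Int1 countable_rat) auto
  moreover have "next_jump_event t s l = {\<omega>\<in>space M.
    (0 < s \<and> (\<forall>r\<in>\<rat> \<inter> {t<..<t + s}. C r \<omega> = C t \<omega> + 0) \<and> C (t + s) \<omega> = C t \<omega> + l) \<or>
    (\<exists>q\<in>\<rat> \<inter> {t<..<t + s}. C q \<omega> = C t \<omega> + l \<and>
      (\<forall>r\<in>\<rat> \<inter> {t<..q}. C r \<omega> = C t \<omega> + 0 \<or> (\<forall>r'\<in>\<rat> \<inter> {r..q}. C r' \<omega> = C t \<omega> + l)))}"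
    unfolding next_jump_event_def add_0_right
    using next_jump_iff_rationals[OF cadlag_C assms(1,3)] by (intro Collect_cong conj_cong) auto
  ultimately show ?thesis by (simp only: pred_def)
qed

text \<open>The jump dynamics at a constant stopping time, tested against a bounded function of the
  past: ordinary integrals replace conditional expectations.\<close>

lemma jump_expectation:
  assumes t: "0 \<le> t" and s: "0 \<le> s" and l: "1 \<le> l"
    and Z: "Z \<in> borel_measurable (natural_filtration M C t)" and bounded: "\<And>\<omega>. \<bar>Z \<omega>\<bar> \<le> B"
  shows "(\<integral>\<omega>. Z \<omega> * indicator (next_jump_event t s l) \<omega> \<partial>M) = (\<integral>\<omega>. Z \<omega> * jump_law t s l (C t \<omega>) \<partial>M)"
    and "integrable M (\<lambda>\<omega>. Z \<omega> * jump_law t s l (C t \<omega>))"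
proof -
  define G where "G = pre_sigma (\<lambda>_. t)"
  have stop: "stopping_time (natural_filtration M C) (\<lambda>_::'a. t)" by (simp add: stopping_time_def)
  \<comment> \<open>At a constant time the stopped sigma-algebra is the past up to \<open>t\<close>:
    the defining condition is trivial for \<open>r < t\<close>, where the set is empty.\<close>
  have sets_G: "sets G = sets (natural_filtration M C t)"
  proof (intro set_eqI iffI)
    fix A assume "A \<in> sets G"
    then show "A \<in> sets (natural_filtration M C t)"
      using sets_pre_sigmaD[OF stop, of A t] by (simp add: G_def)
  next
    fix A assume A: "A \<in> sets (natural_filtration M C t)"
    show "A \<in> sets G" unfolding G_def
    proof (rule sets_pre_sigmaI[OF stop])
      show "{\<omega> \<in> A. t \<le> r} \<in> sets (natural_filtration M C r)" for r
        using A sets_F_mono[of t r] by (cases "t \<le> r") auto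
    qed
  qed
  have space_G: "space G = space M" by (simp add: G_def space_pre_sigma)
  interpret G: finite_measure_subalgebra M G
    by standard (use sets_G sets_natural_filtration_subset space_G in \<open>auto simp: subalgebra_def\<close>)
  have Z_G: "Z \<in> borel_measurable G"
    using Z measurable_cong_sets[OF sets_G refl] by blast
  have Z_M: "Z \<in> borel_measurable M" by (rule measurable_from_subalg[OF G.subalg Z_G])
  let ?J = "indicator (next_jump_event t s l) :: 'a \<Rightarrow> real"
  have J: "?J \<in> borel_measurable M" using t s l by measurable
  have int: "integrable M (\<lambda>\<omega>. Z \<omega> * ?J \<omega>)"
  proof (rule integrable_const_bound[where B = B])
    show "AE \<omega> in M. norm (Z \<omega> * ?J \<omega>) \<le> B"
    proof (rule AE_I2)
      fix \<omega>
      have "0 \<le> B" using order_trans[OF abs_ge_zero bounded[of \<omega>]] .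
      then show "norm (Z \<omega> * ?J \<omega>) \<le> B" using bounded[of \<omega>] by (simp add: indicator_def)
    qed
    show "(\<lambda>\<omega>. Z \<omega> * ?J \<omega>) \<in> borel_measurable M" using Z_M J by measurable
  qed
  have law: "AE \<omega> in M. real_cond_exp M G ?J \<omega> = jump_law t s l (C t \<omega>)"
  proof -
    have "finite_stopping_time M C (\<lambda>_. t)" using stop t by (simp add: finite_stopping_time_def)
    then have "AE \<omega> in M. cond_prob_at M C (\<lambda>_. t) (\<lambda>\<omega>. next_jump (\<lambda>t. C t \<omega>) t s l) \<omega> =
           (let k = real (C t \<omega>) in integral {0..s} (\<lambda>u. k * exp (- k * u) * v l (t + u)))"
      using process s l unfolding tagged_cluster_process_def jump_dynamics_def by blast
    then show ?thesis
      by (simp add: cond_prob_at_def jump_law_def Let_def G_def next_jump_event_def)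
  qed
  have ae: "AE \<omega> in M. Z \<omega> * real_cond_exp M G ?J \<omega> = Z \<omega> * jump_law t s l (C t \<omega>)"
    using law by eventually_elim simp
  have meas: "(\<lambda>\<omega>. Z \<omega> * jump_law t s l (C t \<omega>)) \<in> borel_measurable M"
    using Z_M measurable_C[OF t] by measurable
  have meas': "(\<lambda>\<omega>. Z \<omega> * real_cond_exp M G ?J \<omega>) \<in> borel_measurable M" using Z_M by measurable
  show "(\<integral>\<omega>. Z \<omega> * ?J \<omega> \<partial>M) = (\<integral>\<omega>. Z \<omega> * jump_law t s l (C t \<omega>) \<partial>M)"
    using G.real_cond_exp_intg(2)[OF int Z_G J] integral_cong_AE[OF meas' meas ae] by simp
  show "integrable M (\<lambda>\<omega>. Z \<omega> * jump_law t s l (C t \<omega>))"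
    using G.real_cond_exp_intg(1)[OF int Z_G J] integrable_cong_AE[OF meas' meas ae] by simp
qed

text \<open>By disjointness at most one summand survives.\<close>

lemma sum_indicator_next_jump_event:
  assumes "\<omega> \<in> space M"
  shows "(\<exists>l\<in>{1..L}. \<omega> \<in> next_jump_event t s l \<and> (\<Sum>l=1..L. a l * indicator (next_jump_event t s l) \<omega>) = (a l :: real)) \<or>
    (\<forall>l\<in>{1..L}. \<omega> \<notin> next_jump_event t s l) \<and> (\<Sum>l=1..L. a l * indicator (next_jump_event t s l) \<omega>) = 0"
proof (cases "\<exists>l\<in>{1..L}. \<omega> \<in> next_jump_event t s l")
  case True
  then obtain l where l: "l \<in> {1..L}" "\<omega> \<in> next_jump_event t s l" by blast
  have "indicator (next_jump_event t s l') \<omega> = (if l' = l then 1 else 0 :: real)" if "l' \<in> {1..L}" for l'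
  proof (cases "l' = l")
    case False
    have "\<omega> \<notin> next_jump_event t s l'"
    proof
      assume "\<omega> \<in> next_jump_event t s l'"
      then have "next_jump (\<lambda>t. C t \<omega>) t s l'" "next_jump (\<lambda>t. C t \<omega>) t s l"
        using l(2) by (simp_all add: next_jump_event_def)
      then have "l' = l" by (rule next_jump_increment_unique) (use l(1) that in auto)
      then show False using False by simp
    qed
    then show ?thesis using False by simp
  qed (use l in simp)
  then have "(\<Sum>l=1..L. a l * indicator (next_jump_event t s l) \<omega>) = (\<Sum>l'=1..L. a l' * (if l' = l then 1 else 0))"
    by (intro sum.cong) auto
  then have "(\<Sum>l=1..L. a l * indicator (next_jump_event t s l) \<omega>) = a l"
    using l(1) by (simp add: if_distrib sum.delta cong: if_cong)
  then show ?thesis using l by blast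
next
  case False
  then have "(\<Sum>l=1..L. a l * indicator (next_jump_event t s l) \<omega>) = 0" by (intro sum.neutral) auto
  then show ?thesis using False by blast
qed

lemma AE_next_jump:
  assumes t: "0 \<le> t" shows "AE \<omega> in M. \<exists>s l. 1 \<le> l \<and> next_jump (\<lambda>t. C t \<omega>) t s l"
proof -
  define A where "A = (\<Union>s::nat. \<Union>l\<in>{1..}. next_jump_event t (real s) l)"
  have A [measurable]: "A \<in> sets M"
    unfolding A_def using t by (intro sets.countable_UN'') (auto intro!: sets_next_jump_event sets.countable_UN'')
  \<comment> \<open>The level \<open>L\<close> depends on \<open>e\<close> and \<open>s\<close>, so
    the bound is proved for each pair; then \<open>s\<close> tends to infinity and afterwards
    \<open>e\<close> to 0.\<close>
  have le: "(1 - e) * (1 - exp (- real s)) \<le> prob A" if e: "0 < e" "e \<le> 1" for e s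
  proof -
    obtain L where L: "\<And>k. 1 \<le> k \<Longrightarrow> (1 - e) * (1 - exp (- real s)) \<le> (\<Sum>l=1..L. jump_law t (real s) l k)"
      using jump_law_total_ge[OF t _ e, of "real s"] by auto
    let ?I = "\<lambda>l. indicator (next_jump_event t (real s) l) :: 'a \<Rightarrow> real"
    have exp1: "(\<integral>\<omega>. ?I l \<omega> \<partial>M) = (\<integral>\<omega>. jump_law t (real s) l (C t \<omega>) \<partial>M)"
      "integrable M (\<lambda>\<omega>. jump_law t (real s) l (C t \<omega>))" if "l \<in> {1..L}" for l
      using jump_expectation[OF t, of "real s" l "\<lambda>_. 1" 1] that by auto
    have int_I: "integrable M (?I l)" if "l \<in> {1..L}" for l
      using t that by (intro integrable_real_indicator sets_next_jump_event) (auto simp: emeasure_eq_measure)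
    have "(1 - e) * (1 - exp (- real s)) = (\<integral>\<omega>. (1 - e) * (1 - exp (- real s)) \<partial>M)"
      by (simp add: prob_space)
    also have "\<dots> \<le> (\<integral>\<omega>. (\<Sum>l=1..L. jump_law t (real s) l (C t \<omega>)) \<partial>M)"
      using exp1(2) L C_ge_1 t by (intro integral_mono) auto
    also have "\<dots> = (\<Sum>l=1..L. \<integral>\<omega>. jump_law t (real s) l (C t \<omega>) \<partial>M)"
      using exp1(2) by (intro Bochner_Integration.integral_sum) auto
    also have "\<dots> = (\<Sum>l=1..L. \<integral>\<omega>. ?I l \<omega> \<partial>M)" using exp1(1) by simp
    also have "\<dots> = (\<integral>\<omega>. (\<Sum>l=1..L. ?I l \<omega>) \<partial>M)"
      by (intro Bochner_Integration.integral_sum[symmetric] int_I)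
    also have "\<dots> \<le> (\<integral>\<omega>. indicator A \<omega> \<partial>M)"
    proof (rule integral_mono)
      show "integrable M (\<lambda>\<omega>. \<Sum>l=1..L. ?I l \<omega>)"
        by (intro Bochner_Integration.integrable_sum int_I)
      show "(\<Sum>l=1..L. ?I l \<omega>) \<le> indicator A \<omega>" if "\<omega> \<in> space M" for \<omega>
        using sum_indicator_next_jump_event[OF that, of L t "real s" "\<lambda>_. 1"] by (auto simp: A_def indicator_def)
    qed (use A in \<open>auto intro!: integrable_real_indicator simp: emeasure_eq_measure\<close>)
    also have "\<dots> = prob A" by simp
    finally show ?thesis .
  qed
  have ge: "1 - e \<le> prob A" if e: "0 < e" "e \<le> 1" for e
  proof (rule tendsto_upperbound)
    show "(\<lambda>s. (1 - e) * (1 - exp (- real s))) \<longlonglongrightarrow> 1 - e" by real_asymp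
    show "\<forall>\<^sub>F s in sequentially. (1 - e) * (1 - exp (- real s)) \<le> prob A"
      using le[OF e] by simp
  qed simp
  have "1 \<le> prob A"
  proof (rule field_le_epsilon)
    fix e :: real assume "0 < e"
    then show "1 \<le> prob A + e" using ge[of e] measure_nonneg[of M A] by (cases "e \<le> 1") linarith+
  qed
  then have "prob A = 1" using prob_le_1[of A] by simp
  then have "AE \<omega> in M. \<omega> \<in> A" by (simp add: prob_eq_1)
  then show ?thesis by eventually_elim (auto simp: A_def next_jump_event_def)
qed

section \<open>The killed supermartingale\<close>

text \<open>Rational times make this a countable condition on the past, hence an event of the
  filtration at \<open>t\<close>.\<close>

definition increasing_event :: "real \<Rightarrow> real \<Rightarrow> 'a set" where
  "increasing_event n t = {\<omega>\<in>space M. \<forall>p\<in>\<rat> \<inter> {n..t}. \<forall>q\<in>\<rat> \<inter> {p..t}. C p \<omega> \<le> C q \<omega>}"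

lemma sets_increasing_event:
  assumes "0 \<le> n" shows "increasing_event n t \<in> sets (natural_filtration M C t)"
proof -
  have rel: "Measurable.pred (natural_filtration M C t) (\<lambda>\<omega>. C p \<omega> \<le> C q \<omega>)"
    if "0 \<le> p" "p \<le> t" "0 \<le> q" "q \<le> t" for p q
    using that by (intro pred_relation_countable[where R = "(\<le>)"] measurable_C_natural_filtration)
  have "Measurable.pred (natural_filtration M C t) (\<lambda>\<omega>. \<forall>p\<in>\<rat> \<inter> {n..t}. \<forall>q\<in>\<rat> \<inter> {p..t}. C p \<omega> \<le> C q \<omega>)"
    using assms by (intro pred_countable_Ball rel countable_Int1 countable_rat) auto
  then show ?thesis by (simp add: pred_def space_F increasing_event_def)
qed

text \<open>The one-step estimate is uniform only over states up to \<open>N\<close>. Cutting off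
  there is harmless: an increasing path beyond \<open>N\<close> never returns, so weight is only
  lost.\<close>

definition state_weight :: "nat \<Rightarrow> real \<Rightarrow> nat \<Rightarrow> real" where
  "state_weight N w k = (if k \<le> N then w ^ k else 0)"

text \<open>This is \<open>w ^ C\<close>, killed when the path decreases or exceeds
  \<open>N\<close>. The base \<open>w\<close> is independent of \<open>t\<close>, so that the path
  and the curve can be advanced separately.\<close>

definition surviving_weight :: "nat \<Rightarrow> real \<Rightarrow> real \<Rightarrow> real \<Rightarrow> 'a \<Rightarrow> real" where
  "surviving_weight N n t w \<omega> = indicator (increasing_event n t) \<omega> * state_weight N w (C t \<omega>)"

lemma surviving_weight_measurable:
  assumes "0 \<le> n" "n \<le> t"
  shows "surviving_weight N n t w \<in> borel_measurable (natural_filtration M C t)"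
proof -
  have "(\<lambda>\<omega>. state_weight N w (C t \<omega>)) \<in> borel_measurable (natural_filtration M C t)"
    using assms by (intro measurable_compose[OF measurable_C_natural_filtration[of t t]]) auto
  then show ?thesis
    unfolding surviving_weight_def[abs_def] using sets_increasing_event[OF assms(1), of t]
    by (intro borel_measurable_times borel_measurable_indicator)
qed

lemma surviving_weight_bounds:
  assumes "0 \<le> w" "w \<le> 1"
  shows "0 \<le> surviving_weight N n t w \<omega>" "\<bar>surviving_weight N n t w \<omega>\<bar> \<le> 1"
  using assms by (auto simp: surviving_weight_def state_weight_def indicator_def power_le_one)

lemma integrable_surviving_weight:
  assumes "0 \<le> n" "n \<le> t" "0 \<le> w" "w \<le> 1"
  shows "integrable M (surviving_weight N n t w)"
proof (rule integrable_const_bound[where B = 1])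
  show "surviving_weight N n t w \<in> borel_measurable M"
    using measurable_mono[OF order_refl refl sets_natural_filtration_subset space_F]
      surviving_weight_measurable[OF assms(1,2)] by blast
qed (use surviving_weight_bounds[OF assms(3,4)] in auto)

text \<open>On survival, a first jump by \<open>l\<close> multiplies \<open>w ^ C\<close> by
  \<open>w ^ l\<close> and later ones only lower it; jumps by more than \<open>L\<close> are counted
  as none. If the weight dies, the left side is 0 and the factor on the right is
  nonnegative.\<close>

lemma surviving_weight_step:
  assumes \<omega>: "\<omega> \<in> space M" and t: "0 \<le> n" "n \<le> t" "0 < h" "t \<in> \<rat>" "t + h \<in> \<rat>" and w: "0 \<le> w" "w \<le> 1"
  shows "surviving_weight N n (t + h) w \<omega> \<le>
    surviving_weight N n t w \<omega> * (1 - (\<Sum>l=1..L. (1 - w ^ l) * indicator (next_jump_event t h l) \<omega>))"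
proof -
  define S where "S = (\<Sum>l=1..L. (1 - w ^ l) * indicator (next_jump_event t h l) \<omega> :: real)"
  have S: "(\<exists>l\<in>{1..L}. \<omega> \<in> next_jump_event t h l \<and> S = 1 - w ^ l) \<or> S = 0"
    using sum_indicator_next_jump_event[OF \<omega>, of L t h "\<lambda>l. 1 - w ^ l"] unfolding S_def by blast
  show ?thesis
  proof (cases "\<omega> \<in> increasing_event n (t + h) \<and> C (t + h) \<omega> \<le> N")
    case True
    have mono: "C q \<omega> \<le> C (t + h) \<omega>" if "q \<in> \<rat>" "t \<le> q" "q \<le> t + h" for q
      using True that t by (auto simp: increasing_event_def)
    have inc: "\<omega> \<in> increasing_event n t"
      using True t by (auto simp: increasing_event_def)
    have "C t \<omega> \<le> C (t + h) \<omega>" using mono[of t] t by simp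
    have "w ^ C (t + h) \<omega> \<le> w ^ C t \<omega> * (1 - S)"
      using S
    proof
      assume "\<exists>l\<in>{1..L}. \<omega> \<in> next_jump_event t h l \<and> S = 1 - w ^ l"
      then obtain l where l: "l \<in> {1..L}" "\<omega> \<in> next_jump_event t h l" "S = 1 - w ^ l" by blast
      have "C t \<omega> + l \<le> C (t + h) \<omega>"
        using l t mono
        by (intro next_jump_le_if_mono_rationals[OF cadlag_C[OF \<omega>], of t "t + h" l]) (auto simp: next_jump_event_def)
      then have "w ^ C (t + h) \<omega> \<le> w ^ (C t \<omega> + l)" using w by (intro power_decreasing) auto
      then show ?thesis using l(3) by (simp add: power_add)
    next
      assume "S = 0"
      then show ?thesis using \<open>C t \<omega> \<le> C (t + h) \<omega>\<close> w by (simp add: power_decreasing)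
    qed
    then show ?thesis
      using True inc \<open>C t \<omega> \<le> C (t + h) \<omega>\<close> unfolding S_def[symmetric]
      by (simp add: surviving_weight_def state_weight_def)
  next
    case False
    then have "surviving_weight N n (t + h) w \<omega> = 0"
      by (auto simp: surviving_weight_def state_weight_def)
    moreover have "S \<le> 1" using S w by auto
    ultimately show ?thesis
      using surviving_weight_bounds(1)[OF w, of N n t \<omega>] unfolding S_def[symmetric] by simp
  qed
qed

text \<open>First the path advances with \<open>w\<close> fixed; then the jump indicators are
  replaced by their conditional law, and \<open>le\<close> trades \<open>w\<close> for
  \<open>z\<close> state by state.\<close>

lemma expected_weight_step:
  assumes t: "0 \<le> n" "n \<le> t" "0 < h" "t \<in> \<rat>" "t + h \<in> \<rat>"
    and w: "0 \<le> w" "w \<le> 1" and z: "0 \<le> z" "z \<le> 1" and a: "0 \<le> a"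
    and le: "\<And>k. 1 \<le> k \<Longrightarrow> k \<le> N \<Longrightarrow> w ^ k * (1 - (\<Sum>l=1..L. (1 - w ^ l) * jump_law t h l k)) \<le> a * z ^ k"
  shows "(\<integral>\<omega>. surviving_weight N n (t + h) w \<omega> \<partial>M) \<le> a * (\<integral>\<omega>. surviving_weight N n t z \<omega> \<partial>M)"
proof -
  let ?W = "surviving_weight N n t w"
  let ?J = "\<lambda>l. indicator (next_jump_event t h l) :: 'a \<Rightarrow> real"
  have "0 \<le> t" "0 \<le> h" using t by auto
  have jump: "(\<integral>\<omega>. ?W \<omega> * ?J l \<omega> \<partial>M) = (\<integral>\<omega>. ?W \<omega> * jump_law t h l (C t \<omega>) \<partial>M)"
    "integrable M (\<lambda>\<omega>. ?W \<omega> * jump_law t h l (C t \<omega>))" if "l \<in> {1..L}" for l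
    using that jump_expectation[OF \<open>0 \<le> t\<close> \<open>0 \<le> h\<close> _ surviving_weight_measurable[OF t(1,2)] surviving_weight_bounds(2)[OF w]]
    by auto
  have W: "integrable M ?W" using t w by (intro integrable_surviving_weight)
  have WJ: "integrable M (\<lambda>\<omega>. ?W \<omega> * ?J l \<omega>)" if "l \<in> {1..L}" for l
    using that \<open>0 \<le> t\<close> \<open>0 \<le> h\<close> by (intro integrable_real_mult_indicator W sets_next_jump_event) auto
  have "(\<integral>\<omega>. surviving_weight N n (t + h) w \<omega> \<partial>M)
      \<le> (\<integral>\<omega>. ?W \<omega> - (\<Sum>l=1..L. (1 - w ^ l) * (?W \<omega> * ?J l \<omega>)) \<partial>M)"
  proof (rule integral_mono)
    show "integrable M (surviving_weight N n (t + h) w)" using t w by (intro integrable_surviving_weight) auto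
    show "integrable M (\<lambda>\<omega>. ?W \<omega> - (\<Sum>l=1..L. (1 - w ^ l) * (?W \<omega> * ?J l \<omega>)))"
      by (intro Bochner_Integration.integrable_diff Bochner_Integration.integrable_sum integrable_mult_right W WJ)
    show "surviving_weight N n (t + h) w \<omega> \<le> ?W \<omega> - (\<Sum>l=1..L. (1 - w ^ l) * (?W \<omega> * ?J l \<omega>))"
      if "\<omega> \<in> space M" for \<omega>
      using surviving_weight_step[OF that t w, of N L] by (simp add: algebra_simps sum_distrib_left)
  qed
  also have "\<dots> = (\<integral>\<omega>. ?W \<omega> \<partial>M) - (\<Sum>l=1..L. (1 - w ^ l) * (\<integral>\<omega>. ?W \<omega> * ?J l \<omega> \<partial>M))"
    by (rule integral_diff_sum[OF W WJ])
  also have "\<dots> = (\<integral>\<omega>. ?W \<omega> \<partial>M) - (\<Sum>l=1..L. (1 - w ^ l) * (\<integral>\<omega>. ?W \<omega> * jump_law t h l (C t \<omega>) \<partial>M))"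
    using jump(1) by simp
  also have "\<dots> = (\<integral>\<omega>. ?W \<omega> - (\<Sum>l=1..L. (1 - w ^ l) * (?W \<omega> * jump_law t h l (C t \<omega>))) \<partial>M)"
    by (rule integral_diff_sum[OF W jump(2), symmetric])
  also have "\<dots> \<le> (\<integral>\<omega>. a * surviving_weight N n t z \<omega> \<partial>M)"
  proof (rule integral_mono)
    show "integrable M (\<lambda>\<omega>. ?W \<omega> - (\<Sum>l=1..L. (1 - w ^ l) * (?W \<omega> * jump_law t h l (C t \<omega>))))"
      by (intro Bochner_Integration.integrable_diff Bochner_Integration.integrable_sum integrable_mult_right W jump(2))
    show "integrable M (\<lambda>\<omega>. a * surviving_weight N n t z \<omega>)"
      using t z by (intro integrable_mult_right integrable_surviving_weight)
    fix \<omega> assume \<omega>: "\<omega> \<in> space M"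
    define k where "k = C t \<omega>"
    have "state_weight N w k * (1 - (\<Sum>l=1..L. (1 - w ^ l) * jump_law t h l k)) \<le> a * state_weight N z k"
      using le[of k] C_ge_1[OF \<omega> \<open>0 \<le> t\<close>] by (auto simp: state_weight_def k_def)
    then have "indicator (increasing_event n t) \<omega> *
        (state_weight N w k * (1 - (\<Sum>l=1..L. (1 - w ^ l) * jump_law t h l k)))
      \<le> indicator (increasing_event n t) \<omega> * (a * state_weight N z k)"
      by (intro mult_left_mono) auto
    then show "?W \<omega> - (\<Sum>l=1..L. (1 - w ^ l) * (?W \<omega> * jump_law t h l (C t \<omega>))) \<le> a * surviving_weight N n t z \<omega>"
      by (simp add: surviving_weight_def k_def[symmetric] algebra_simps sum_distrib_left)
  qed
  finally show ?thesis by simp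
qed

text \<open>The weight starts below \<open>z n\<close>, because \<open>C >= 1\<close>, and ends as
  an indicator, because \<open>z y = 1\<close>. The factors \<open>exp (e * h)\<close> multiply to
  \<open>exp (e * (y - n))\<close> whatever the mesh, so \<open>e\<close> can tend to 0 for fixed
  \<open>N\<close>, and then \<open>N\<close> to infinity.\<close>

lemma prob_increasing_le:
  assumes c: "characteristic_curve v y z" and n: "0 \<le> n" "n \<in> \<rat>" and y: "n < y" "y \<in> \<rat>"
  shows "prob (increasing_event n y) \<le> z n"
proof -
  have range: "0 \<le> z t" "z t \<le> 1" if "0 \<le> t" for t using curve_range[OF c that] by auto
  have bound: "(\<integral>\<omega>. surviving_weight N n y 1 \<omega> \<partial>M) \<le> exp (e * (y - n)) * z n" if e: "0 < e" and N: "1 \<le> N" for e N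
  proof -
    obtain d L where d: "0 < d" and step: "\<And>t h k. 0 \<le> t \<Longrightarrow> 0 < h \<Longrightarrow> h \<le> d \<Longrightarrow> t + h \<le> y \<Longrightarrow> 1 \<le> k \<Longrightarrow> k \<le> N \<Longrightarrow>
        z (t + h) ^ k * (1 - (\<Sum>l=1..L. (1 - z (t + h) ^ l) * jump_law t h l k)) \<le> exp (e * h) * z t ^ k"
      using one_step_supermartingale[OF c e N] by blast
    obtain m :: nat where m: "(y - n) / d < real m" using reals_Archimedean2 by blast
    have "0 < (y - n) / d" using y d by simp
    then have "0 < m" using m by (cases m) auto
    \<comment> \<open>The mesh is rational because \<open>n\<close> and \<open>y\<close> are, so
      \<open>increasing_event\<close> sees every grid time.\<close>
    define h where "h = (y - n) / real m"
    have h: "0 < h" "h \<le> d" "h \<in> \<rat>" "n + real m * h = y"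
      using y n d m \<open>0 < m\<close> by (auto simp: h_def field_simps)
    have "(\<integral>\<omega>. surviving_weight N n (n + real j * h) (z (n + real j * h)) \<omega> \<partial>M)
        \<le> exp (e * (real j * h)) * (\<integral>\<omega>. surviving_weight N n n (z n) \<omega> \<partial>M)" if "j \<le> m" for j
      using that
    proof (induction j)
      case (Suc j)
      have next_time: "n + real (Suc j) * h = n + real j * h + h" by (simp add: algebra_simps)
      have "real (Suc j) * h \<le> real m * h" using Suc.prems h by (intro mult_right_mono) auto
      then have le_y: "n + real j * h + h \<le> y" using h(4) next_time by linarith
      have pos: "0 \<le> real j * h" using h by simp
      have "(\<integral>\<omega>. surviving_weight N n (n + real j * h + h) (z (n + real j * h + h)) \<omega> \<partial>M)
          \<le> exp (e * h) * (\<integral>\<omega>. surviving_weight N n (n + real j * h) (z (n + real j * h)) \<omega> \<partial>M)"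
        using n h pos le_y by (intro expected_weight_step[where L = L] range step) auto
      also have "\<dots> \<le> exp (e * h) * (exp (e * (real j * h)) * (\<integral>\<omega>. surviving_weight N n n (z n) \<omega> \<partial>M))"
        using Suc by (intro mult_left_mono) auto
      also have "\<dots> = exp (e * (real (Suc j) * h)) * (\<integral>\<omega>. surviving_weight N n n (z n) \<omega> \<partial>M)"
        by (simp add: algebra_simps flip: exp_add)
      finally show ?case by (simp only: next_time)
    qed simp
    note grid = this
    have mh: "real m * h = y - n" using h(4) by simp
    have "(\<integral>\<omega>. surviving_weight N n y 1 \<omega> \<partial>M)
        \<le> exp (e * (y - n)) * (\<integral>\<omega>. surviving_weight N n n (z n) \<omega> \<partial>M)"
      using grid[of m, OF order_refl] curve_eq_1[OF c, of y] n y unfolding h(4) mh by simp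
    also have "\<dots> \<le> exp (e * (y - n)) * (\<integral>\<omega>. z n \<partial>M)"
    proof (intro mult_left_mono integral_mono)
      show "integrable M (surviving_weight N n n (z n))"
        using n range by (intro integrable_surviving_weight) auto
      fix \<omega> assume "\<omega> \<in> space M"
      then have "z n ^ C n \<omega> \<le> z n ^ 1" using C_ge_1[of \<omega> n] n range[of n] by (intro power_decreasing) auto
      then show "surviving_weight N n n (z n) \<omega> \<le> z n"
        using range[OF n(1)] by (auto simp: surviving_weight_def state_weight_def indicator_def)
    qed auto
    finally show ?thesis by (simp add: prob_space)
  qed
  have "(\<integral>\<omega>. surviving_weight N n y 1 \<omega> \<partial>M) \<le> z n" if N: "1 \<le> N" for N
  proof (rule tendsto_lowerbound)
    have "((\<lambda>e. exp (e * (y - n)) * z n) \<longlongrightarrow> exp (0 * (y - n)) * z n) (at_right 0)"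
      by (intro tendsto_intros)
    then show "((\<lambda>e. exp (e * (y - n)) * z n) \<longlongrightarrow> z n) (at_right 0)" by simp
    show "eventually (\<lambda>e. (\<integral>\<omega>. surviving_weight N n y 1 \<omega> \<partial>M) \<le> exp (e * (y - n)) * z n) (at_right 0)"
      using eventually_at_right_less[of 0] by eventually_elim (rule bound[OF _ N])
  qed simp
  note le = this
  have sets: "increasing_event n y \<in> sets M"
    using sets_increasing_event[OF n(1)] sets_natural_filtration_subset by blast
  have "(\<lambda>N. \<integral>\<omega>. surviving_weight N n y 1 \<omega> \<partial>M) \<longlonglongrightarrow> (\<integral>\<omega>. indicator (increasing_event n y) \<omega> \<partial>M)"
  proof (rule integral_dominated_convergence[where w = "\<lambda>_. 1"])
    show "surviving_weight N n y 1 \<in> borel_measurable M" for N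
      using integrable_surviving_weight[of n y 1 N] n y by (intro borel_measurable_integrable) auto
    show "AE \<omega> in M. (\<lambda>N. surviving_weight N n y 1 \<omega>) \<longlonglongrightarrow> indicator (increasing_event n y) \<omega>"
    proof (rule AE_I2)
      fix \<omega>
      have "eventually (\<lambda>N. surviving_weight N n y 1 \<omega> = indicator (increasing_event n y) \<omega>) sequentially"
        using eventually_ge_at_top[of "C y \<omega>"]
        by eventually_elim (simp add: surviving_weight_def state_weight_def)
      then show "(\<lambda>N. surviving_weight N n y 1 \<omega>) \<longlonglongrightarrow> indicator (increasing_event n y) \<omega>"
        by (rule tendsto_eventually)
    qed
    show "AE \<omega> in M. norm (surviving_weight N n y 1 \<omega>) \<le> 1" for N
      using surviving_weight_bounds(2)[of 1 N n y] by auto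
  qed (use sets in auto)
  then have "(\<integral>\<omega>. indicator (increasing_event n y) \<omega> \<partial>M) \<le> z n"
    by (rule LIMSEQ_le_const2) (use le in blast)
  then show ?thesis using sets by simp
qed

lemma AE_infinitely_many_explosions:
  assumes curves: "\<And>y. y0 < y \<Longrightarrow> characteristic_curve v y (\<psi> y)"
  shows "AE \<omega> in M. infinite {t. explodes_at (\<lambda>s. C s \<omega>) t}"
proof -
  have "AE \<omega> in M. \<exists>m::nat. \<omega> \<notin> increasing_event (real n) (real m)" for n :: nat
  proof -
    define I where "I = (\<Inter>m::nat. increasing_event (real n) (real m))"
    have sets: "increasing_event (real n) (real m) \<in> sets M" for m
      using sets_increasing_event[of "real n"] sets_natural_filtration_subset by auto
    then have I: "I \<in> sets M" unfolding I_def by auto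
    have "eventually (\<lambda>m. prob I \<le> \<psi> (real m) (real n)) sequentially"
    proof -
      obtain m0 :: nat where m0: "max y0 (real n) < real m0" using reals_Archimedean2 by blast
      have "prob I \<le> \<psi> (real m) (real n)" if "m \<ge> m0" for m
      proof -
        have m: "y0 < real m" "real n < real m" using m0 that by auto
        have "prob I \<le> prob (increasing_event (real n) (real m))"
          using sets by (intro finite_measure_mono) (auto simp: I_def)
        also have "\<dots> \<le> \<psi> (real m) (real n)"
          using m by (intro prob_increasing_le curves) auto
        finally show ?thesis .
      qed
      then show ?thesis by (auto simp: eventually_sequentially)
    qed
    moreover have "(\<lambda>m. \<psi> (real m) (real n)) \<longlonglongrightarrow> 0"
      using curves_tendsto_0[of y0 \<psi> "real n"] curves
      by (intro filterlim_compose[OF _ filterlim_real_sequentially, of "\<lambda>y. \<psi> y (real n)"]) auto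
    ultimately have "prob I \<le> 0" by (intro tendsto_lowerbound[of "\<lambda>m. \<psi> (real m) (real n)"]) auto
    then have "prob I = 0" using measure_nonneg[of M I] by linarith
    then have "AE \<omega> in M. \<omega> \<notin> I" using I by (simp add: prob_eq_0)
    then show ?thesis by eventually_elim (simp add: I_def)
  qed
  then have not_increasing: "AE \<omega> in M. \<forall>n::nat. \<exists>m::nat. \<omega> \<notin> increasing_event (real n) (real m)"
    by (simp add: AE_all_countable)
  \<comment> \<open>A null set is discarded for each of countably many times; rational times are all
    that the pathwise argument asks for.\<close>
  have next_jumps: "AE \<omega> in M. \<forall>q\<in>\<rat> \<inter> {0..}. \<exists>s l. 1 \<le> l \<and> next_jump (\<lambda>t. C t \<omega>) q s l"
    using AE_next_jump by (subst AE_ball_countable) (auto intro: countable_Int1 countable_rat)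
  have jumps_only: "AE \<omega> in M. jumps_only_out_of_states (\<lambda>t. C t \<omega>)"
    using process by (auto simp: tagged_cluster_process_def)
  show ?thesis
    using not_increasing next_jumps jumps_only AE_space
  proof eventually_elim
    case (elim \<omega>)
    show ?case
    proof
      assume "finite {t. explodes_at (\<lambda>s. C s \<omega>) t}"
      then obtain b where b: "\<And>t. explodes_at (\<lambda>s. C s \<omega>) t \<Longrightarrow> t \<le> b"
        using bdd_above_finite[of "{t. explodes_at (\<lambda>s. C s \<omega>) t}"] unfolding bdd_above_def by blast
      obtain n :: nat where n: "b < real n" using reals_Archimedean2 by blast
      \<comment> \<open>Beyond the last of finitely many explosions the path would be monotone,
        against \<open>not_increasing\<close>.\<close>
      have mono: "mono_on {real n..} (\<lambda>t. C t \<omega>)"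
      proof (rule mono_if_no_explosion)
        show "\<exists>s l. 1 \<le> l \<and> next_jump (\<lambda>t. C t \<omega>) q s l" if "q \<in> \<rat>" "real n \<le> q" for q
          using elim that by auto
        show "\<not> explodes_at (\<lambda>s. C s \<omega>) t" if "real n < t" for t using b[of t] n that by auto
      qed (use elim cadlag_C in auto)
      have "\<omega> \<in> increasing_event (real n) (real m)" for m
        using elim mono_onD[OF mono] by (auto simp: increasing_event_def)
      then show False using elim by blast
    qed
  qed
qed

end

theorem lemma3p15:
  fixes v0 :: "nat \<Rightarrow> real"
    and v :: "nat \<Rightarrow> real \<Rightarrow> real"
    and \<psi> :: "real \<Rightarrow> real \<Rightarrow> real"
    and M :: "'a measure"
    and C :: "real \<Rightarrow> 'a \<Rightarrow> nat"
  assumes "admissible_initial v0"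
    and "critical_forest_fire_solution v0 v"
    and "\<And>y. T_gel v0 < y \<Longrightarrow> characteristic_curve v y (\<psi> y)"
    and "tagged_cluster_process v M C"
  shows "(\<forall>t\<ge>0. ((\<lambda>y. \<psi> y t) \<longlongrightarrow> 0) at_top) \<and>
         (\<forall>t\<ge>0. \<forall>z\<in>{0<..<1}. \<exists>y>T_gel v0. \<psi> y t = z) \<and>
         (AE \<omega> in M. infinite {t. explodes_at (\<lambda>s. C s \<omega>) t})"
proof -
  interpret tagged_cluster v0 v M C
    by unfold_locales (use assms in auto)
  show ?thesis
    using curves_tendsto_0[OF assms(3)] curves_fill[OF assms(3)] AE_infinitely_many_explosions[OF assms(3)]
    by auto
qed

end
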